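(* Let $n=4$ and let $\omega$ be the Minkowski metric. The system for the unknowns $\lambda^{rs}=\lambda^{sr}$ with second members $\sigma^{rs}=\sigma^{sr}$ ($1\le r,s\le 4$), made by $$\Box\lambda^{rs}=\sigma^{rs},\qquad d_r\lambda^{rs}=0$$ (summation over the repeated index $r$ in the second set of equations), is a relative minimum involutive parametrization of the Cauchy equations $d_r\sigma^{rs}=0$, which describe the formal adjoint of the Killing operator, that is, $Cauchy=ad(Killing)$ as operators.
   Context: Let $K$ be a differential field of characteristic zero with commuting derivations $\partial_1,\dots,\partial_n$, and let $D=K[d_1,\dots,d_n]$ be the ring of differential operators with $d_ia=ad_i+\partial_ia$ for $a\in K$; $d_{ij}=d_id_j$. Here $n=4$. The Minkowski metric $\omega=(\omega_{ij})$ has constant coefficients, with inverse $(\omega^{ij})$, and $\Box=\omega^{ij}d_{ij}$ is the d'Alembertian. Repeated indices are summed. Killing operator: $\xi\mapsto\Omega=\mathcal{L}(\xi)\omega\in S_2T^*$, i.e. $\Omega_{ij}=\omega_{rj}\partial_i\xi^r+\omega_{ir}\partial_j\xi^r$. The formal adjoint $ad(P)$ of a (matrix) operator $P$ is obtained by multiplying on the left by test functions and integrating by parts: for $P=a^\mu d_\mu$, $ad(P)=(-1)^{|\mu|}d_\mu a^\mu$, with transposition for matrices. The test functions for the Killing operator are symmetric tensor densities $\sigma=(\sigma^{ij})\in\wedge^4T^*\otimes S_2T$, and its adjoint gives, up to sign, a constant factor and lowering an index with $\omega$, the Cauchy operator $\sigma\mapsto (d_r\sigma^{rs})_s$. The unknowns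 $\lambda=(\lambda^{ij})\in\wedge^4T^*\otimes S_2T$ are the potentials. Relative parametrization: a linear differential system giving $\sigma$ in terms of potentials $\lambda$, together with homogeneous linear differential constraints imposed on $\lambda$, is a relative parametrization of the system $d_r\sigma^{rs}=0$ if the compatibility conditions on $\sigma$ of the resulting inhomogeneous system (unknown $\lambda$, second members $\sigma$ and $0$) are generated by $d_r\sigma^{rs}=0$ alone. Minimum: the parametrization is minimum (minimal) if the homogeneous system for $\lambda$ obtained by setting $\sigma=0$ (constraints included) defines a torsion differential module, equivalently a differential module of differential rank $0$ over $D$. Involutive: the second order system considered consists of $\Box\lambda^{rs}=\sigma^{rs}$, the first order constraints $d_r\lambda^{rs}=0$, and their first derivatives $d_id_r\lambda^{rs}=0$. A jet $y^k_\mu$ has class $i$ if $\mu_1=\dots=\mu_{i-1}=0$, $\mu_i\ne0$. For a linear system of order $q$, after a linear change of independent variables if necessary, one solves the maximum number of equations with respect to jets of order $q$ and class $n$ (multiplicative variables $x^1,\dots,x^n$), then for $i=n-1,\dots,1$ the maximum number of remaining equations with respect to jets of order $q$ and class $i$ (multiplicative variables $x^1,\dots,x^i$); the remaining equations, of order $\le q-1$, have no multiplicative variables. The system is involutive if its first prolongation (all the equations together with all their first formal derivatives) can be achieved by prolonging each equation only with respect to its multiplicative variables. *)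

theory Defs
  imports
    "HOL-Analysis.Analysis"
    "HOL-Library.Poly_Mapping"
    "HOL-Library.Uprod"
begin

section \<open>Differential fields with four commuting derivations\<close>

text \<open>
  The independent variables \<open>x\<^sup>1, x\<^sup>2, x\<^sup>3, x\<^sup>4\<close> are indexed by the four-element type \<open>4\<close>,
  listed in its own linear order as \<open>0 < 1 < 2 < 3\<close>.  Note that the numeral \<open>4 :: 4\<close> equals \<open>0\<close>.
\<close>

lemma index_4_eq_0: "(4::4) = 0"
  by simp

lemma index_cases: "i = 0 \<or> i = 1 \<or> i = 2 \<or> i = (3::4)"
  using exhaust_4[of i] unfolding index_4_eq_0 by blast

lemma index_less: "(0::4) < 1" "(1::4) < 2" "(2::4) < 3"
  by (simp_all add: less_bit0_def bit0.Rep_numeral bit0.Rep_0 bit0.Rep_1)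

class differential_field = field_char_0 +
  fixes derivation :: "4 \<Rightarrow> 'a \<Rightarrow> 'a"
  assumes derivation_add: "derivation i (a + b) = derivation i a + derivation i b"
    and derivation_mult: "derivation i (a * b) = derivation i a * b + a * derivation i b"
    and derivation_commute: "derivation i (derivation j a) = derivation j (derivation i a)"
begin

lemma derivation_0 [simp]: "derivation i 0 = 0"
  using derivation_add[of i 0 0] by simp

lemma derivation_1 [simp]: "derivation i 1 = 0"
  using derivation_mult[of i 1 1] by simp

end


section \<open>The ring of differential operators\<close>

type_synonym multi_index = "4 \<Rightarrow>\<^sub>0 nat"

text \<open>
  An operator \<open>\<Sum>\<^sub>\<mu> a\<^sub>\<mu> d\<^sub>\<mu>\<close> is stored as the finitely supported family of its left coefficients.
  The type is a copy of the one of polynomials, because the product is twisted.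
\<close>

typedef (overloaded) 'k dop = "UNIV :: (multi_index \<Rightarrow>\<^sub>0 'k::zero) set"
  morphisms coeffs Dop ..

lemma coeffs_Dop [simp]: "coeffs (Dop p) = p"
  by (rule Dop_inverse) simp

lemma dop_eq_iff: "P = Q \<longleftrightarrow> coeffs P = coeffs Q"
  by (simp add: coeffs_inject)

abbreviation coef :: "'k::zero dop \<Rightarrow> multi_index \<Rightarrow> 'k" where
  "coef P \<equiv> Poly_Mapping.lookup (coeffs P)"

definition unit_index :: "4 \<Rightarrow> multi_index" where
  "unit_index i = Poly_Mapping.single i 1"

text \<open>
  Left multiplication by \<open>d\<^sub>i\<close> sends \<open>a d\<^sub>\<mu>\<close> to \<open>(\<partial>\<^sub>i a) d\<^sub>\<mu> + a d\<^sub>\<mu>\<^sub>+\<^sub>1\<^sub>i\<close>; in the following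
  definition the product is the commutative one of polynomials.  Left multiplication by \<open>d\<^sub>\<mu>\<close> is
  its iterate, and the product of \<open>D\<close> is the resulting one.
\<close>

definition left_d :: "4 \<Rightarrow> (multi_index \<Rightarrow>\<^sub>0 'k) \<Rightarrow> (multi_index \<Rightarrow>\<^sub>0 'k::differential_field)" where
  "left_d i p = Poly_Mapping.map (derivation i) p + Poly_Mapping.single (unit_index i) 1 * p"

definition left_mono ::
    "multi_index \<Rightarrow> (multi_index \<Rightarrow>\<^sub>0 'k) \<Rightarrow> (multi_index \<Rightarrow>\<^sub>0 'k::differential_field)" where
  "left_mono \<mu> =
     (left_d 0 ^^ Poly_Mapping.lookup \<mu> 0) \<circ> (left_d 1 ^^ Poly_Mapping.lookup \<mu> 1) \<circ>
     (left_d 2 ^^ Poly_Mapping.lookup \<mu> 2) \<circ> (left_d 3 ^^ Poly_Mapping.lookup \<mu> 3)"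

definition twisted_mult ::
    "(multi_index \<Rightarrow>\<^sub>0 'k) \<Rightarrow> (multi_index \<Rightarrow>\<^sub>0 'k) \<Rightarrow> (multi_index \<Rightarrow>\<^sub>0 'k::differential_field)" where
  "twisted_mult p q =
     (\<Sum>\<mu>\<in>Poly_Mapping.keys p.
        Poly_Mapping.single 0 (Poly_Mapping.lookup p \<mu>) * left_mono \<mu> q)"

lemma lookup_scale:
  "Poly_Mapping.lookup (Poly_Mapping.single 0 c * p) m = c * Poly_Mapping.lookup p m"
  for c :: "'k::comm_ring_1" and p :: "multi_index \<Rightarrow>\<^sub>0 'k"
  by (simp add: mult_map_scale_conv_mult[symmetric] map.rep_eq when_def)

lemma lookup_map_derivation:
  "Poly_Mapping.lookup (Poly_Mapping.map (derivation i) p) m = derivation i (Poly_Mapping.lookup p m)"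
  by (simp add: map.rep_eq when_def)

lemma map_derivation_0 [simp]: "Poly_Mapping.map (derivation i) 0 = 0"
  by (rule poly_mapping_eqI) (simp add: lookup_map_derivation)

lemma map_derivation_single [simp]:
  "Poly_Mapping.map (derivation i) (Poly_Mapping.single m a) = Poly_Mapping.single m (derivation i a)"
  by (rule poly_mapping_eqI) (simp add: lookup_map_derivation lookup_single when_def)

lemma map_derivation_add:
  "Poly_Mapping.map (derivation i) (p + q) =
     Poly_Mapping.map (derivation i) p + Poly_Mapping.map (derivation i) q"
  by (rule poly_mapping_eqI) (simp add: lookup_map_derivation lookup_add derivation_add)

lemma map_derivation_scale:
  "Poly_Mapping.map (derivation i) (Poly_Mapping.single 0 c * p) =
     Poly_Mapping.single 0 (derivation i c) * p +
     Poly_Mapping.single 0 c * Poly_Mapping.map (derivation i) p"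
  for p :: "multi_index \<Rightarrow>\<^sub>0 'k::differential_field"
  by (rule poly_mapping_eqI) (simp add: lookup_map_derivation lookup_add lookup_scale derivation_mult)

lemma poly_mapping_add_induct [case_names zero single add]:
  assumes "P 0" "\<And>m a. P (Poly_Mapping.single m a)" "\<And>p q. P p \<Longrightarrow> P q \<Longrightarrow> P (p + q)"
  shows "P (p :: 'm \<Rightarrow>\<^sub>0 'k::ab_group_add)"
proof (induction p rule: update_induct)
  case const
  show ?case by (rule assms(1))
next
  case (update p m a)
  have "Poly_Mapping.update m a p = p + Poly_Mapping.single m a"
    by (rule poly_mapping_eqI)
      (use update in \<open>auto simp: lookup_update lookup_add lookup_single when_def
        not_in_keys_iff_lookup_eq_zero\<close>)
  then show ?case using update assms by auto
qed

lemma map_derivation_shift: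
  "Poly_Mapping.map (derivation i) (Poly_Mapping.single m 1 * p) =
     Poly_Mapping.single m 1 * Poly_Mapping.map (derivation i) p"
  for p :: "multi_index \<Rightarrow>\<^sub>0 'k::differential_field"
  by (induction p rule: poly_mapping_add_induct)
    (simp_all add: map_derivation_add distrib_left mult_single)

lemma left_d_add: "left_d i (p + q) = left_d i p + left_d i q"
  by (simp add: left_d_def map_derivation_add algebra_simps)

lemma left_d_scale:
  "left_d i (Poly_Mapping.single 0 c * p) =
     Poly_Mapping.single 0 (derivation i c) * p + Poly_Mapping.single 0 c * left_d i p"
  by (simp add: left_d_def map_derivation_scale distrib_left mult.left_commute add.assoc)

lemma left_d_single:
  "left_d i (Poly_Mapping.single m a) =
     Poly_Mapping.single m (derivation i a) + Poly_Mapping.single (unit_index i + m) a"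
  by (simp add: left_d_def mult_single)

lemma left_d_commute: "left_d i (left_d j p) = left_d j (left_d i p)"
proof -
  have "Poly_Mapping.map (derivation i) (Poly_Mapping.map (derivation j) p) =
      Poly_Mapping.map (derivation j) (Poly_Mapping.map (derivation i) p)"
    by (rule poly_mapping_eqI) (simp add: lookup_map_derivation derivation_commute)
  then show ?thesis
    by (simp add: left_d_def map_derivation_add map_derivation_shift distrib_left
        mult.left_commute add_ac)
qed

lemma funpow_left_d_commute:
  "(left_d i ^^ a) ((left_d j ^^ b) p) = (left_d j ^^ b) ((left_d i ^^ a) p)"
proof -
  have 1: "left_d i ((left_d j ^^ b) p) = (left_d j ^^ b) (left_d i p)" for p
    by (induction b) (simp_all add: left_d_commute[of i j])
  show ?thesis by (induction a arbitrary: p) (simp_all add: 1)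
qed

lemma left_mono_0 [simp]: "left_mono 0 p = p"
  by (simp add: left_mono_def)

lemma left_mono_plus: "left_mono (\<mu> + \<nu>) p = left_mono \<mu> (left_mono \<nu> p)"
  by (simp add: left_mono_def lookup_add funpow_add funpow_left_d_commute)

lemma left_mono_unit [simp]: "left_mono (unit_index i) p = left_d i p"
proof -
  show ?thesis using index_cases[of i] by (auto simp: left_mono_def unit_index_def lookup_single when_def)
qed

lemma multi_index_induct [case_names zero step]:
  assumes "P 0" "\<And>\<mu> i. P \<mu> \<Longrightarrow> P (unit_index i + \<mu>)"
  shows "P (\<mu> :: multi_index)"
proof -
  have "P (Poly_Mapping.single i n + \<mu>)" if "P \<mu>" for i n \<mu>
  proof (induction n)
    case (Suc n)
    have "Poly_Mapping.single i (Suc n) = unit_index i + Poly_Mapping.single i n"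
      by (simp add: unit_index_def single_add[symmetric])
    then show ?case using assms(2)[OF Suc] by (simp add: add.assoc)
  qed (simp add: that)
  note * = this
  have "P (\<mu> + \<nu>)" if "P \<nu>" for \<mu> \<nu> :: multi_index
    using that
  proof (induction \<mu> arbitrary: \<nu> rule: update_induct)
    case (update p m a)
    have "Poly_Mapping.update m a p = Poly_Mapping.single m a + p"
      by (rule poly_mapping_eqI)
        (use update in \<open>auto simp: lookup_update lookup_add lookup_single when_def
          not_in_keys_iff_lookup_eq_zero\<close>)
    then show ?case using update *[of "p + \<nu>" m a] by (simp add: add.assoc)
  qed simp
  from this[of 0 \<mu>] show ?thesis using assms(1) by simp
qed

lemma left_mono_step: "left_mono (unit_index i + \<mu>) p = left_d i (left_mono \<mu> p)"
  by (simp add: left_mono_plus)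

lemma left_mono_add: "left_mono \<mu> (p + q) = left_mono \<mu> p + left_mono \<mu> q"
  by (induction \<mu> rule: multi_index_induct) (simp_all add: left_mono_step left_d_add)

lemma left_mono_one: "left_mono \<mu> 1 = Poly_Mapping.single \<mu> 1"
proof (induction \<mu> rule: multi_index_induct)
  case (step \<mu> i)
  then show ?case by (simp add: left_mono_step left_d_single)
qed simp

lemma twisted_mult_superset:
  assumes "finite S" "Poly_Mapping.keys p \<subseteq> S"
  shows "twisted_mult p q =
    (\<Sum>\<mu>\<in>S. Poly_Mapping.single 0 (Poly_Mapping.lookup p \<mu>) * left_mono \<mu> q)"
  unfolding twisted_mult_def
  by (rule sum.mono_neutral_left) (use assms in \<open>auto simp: in_keys_iff\<close>)

lemma twisted_mult_add_left: "twisted_mult (p + p') q = twisted_mult p q + twisted_mult p' q"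
proof -
  let ?S = "Poly_Mapping.keys p \<union> Poly_Mapping.keys p'"
  have "Poly_Mapping.keys (p + p') \<subseteq> ?S" by (rule keys_add)
  then show ?thesis
    by (simp add: twisted_mult_superset[of ?S] lookup_add single_add distrib_right sum.distrib)
qed

lemma twisted_mult_add_right: "twisted_mult p (q + q') = twisted_mult p q + twisted_mult p q'"
  by (simp add: twisted_mult_def left_mono_add distrib_left sum.distrib)

lemma twisted_mult_0_left [simp]: "twisted_mult 0 q = 0"
  by (simp add: twisted_mult_def)

lemma twisted_mult_0_right [simp]: "twisted_mult p 0 = 0"
  using twisted_mult_add_right[of p 0 0] by simp

lemma twisted_mult_single:
  "twisted_mult (Poly_Mapping.single \<mu> a) q = Poly_Mapping.single 0 a * left_mono \<mu> q"
  by (subst twisted_mult_superset[of "{\<mu>}"]) auto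

lemma twisted_mult_scale:
  "twisted_mult (Poly_Mapping.single 0 c * p) q = Poly_Mapping.single 0 c * twisted_mult p q"
proof (induction p rule: poly_mapping_add_induct)
  case (single m a)
  have "Poly_Mapping.single (0::multi_index) (c * a) = Poly_Mapping.single 0 c * Poly_Mapping.single 0 a"
    by (simp add: mult_single)
  then show ?case by (simp add: mult_single twisted_mult_single mult.assoc)
qed (simp_all add: twisted_mult_add_left distrib_left)

lemma twisted_mult_left_d: "twisted_mult (left_d i p) q = left_d i (twisted_mult p q)"
proof (induction p rule: poly_mapping_add_induct)
  case zero
  then show ?case by (simp add: left_d_def)
next
  case (single m a)
  show ?case
    by (simp add: left_d_single twisted_mult_add_left twisted_mult_single left_d_scale left_mono_step)
next
  case (add p q)
  then show ?case by (simp add: left_d_add twisted_mult_add_left)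
qed

lemma twisted_mult_left_mono: "twisted_mult (left_mono \<mu> p) q = left_mono \<mu> (twisted_mult p q)"
  by (induction \<mu> rule: multi_index_induct) (simp_all add: left_mono_step twisted_mult_left_d)

lemma twisted_mult_assoc:
  "twisted_mult (twisted_mult p q) r = twisted_mult p (twisted_mult q r)"
  by (induction p rule: poly_mapping_add_induct)
    (simp_all add: twisted_mult_add_left twisted_mult_single twisted_mult_scale twisted_mult_left_mono)

lemma twisted_mult_1_left: "twisted_mult 1 q = q"
  using twisted_mult_single[of 0 1 q] by simp

lemma twisted_mult_1_right: "twisted_mult p 1 = p"
  by (induction p rule: poly_mapping_add_induct)
    (simp_all add: twisted_mult_add_left twisted_mult_single left_mono_one mult_single)

instantiation dop :: (differential_field) ring_1
begin

definition "0 = Dop 0"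
definition "1 = Dop 1"
definition "P + Q = Dop (coeffs P + coeffs Q)"
definition "P - Q = Dop (coeffs P - coeffs Q)"
definition "- P = Dop (- coeffs P)" for P :: "'a dop"
definition "P * Q = Dop (twisted_mult (coeffs P) (coeffs Q))"

instance
  by standard
    (simp_all add: dop_eq_iff zero_dop_def one_dop_def plus_dop_def minus_dop_def uminus_dop_def
      times_dop_def twisted_mult_assoc twisted_mult_1_left twisted_mult_1_right
      twisted_mult_add_left twisted_mult_add_right add.assoc add.commute)

end

definition dconst :: "'k \<Rightarrow> 'k::differential_field dop" where
  "dconst a = Dop (Poly_Mapping.single 0 a)"

definition dvar :: "4 \<Rightarrow> 'k::differential_field dop" where
  "dvar i = Dop (Poly_Mapping.single (unit_index i) 1)"

lemma dvar_dconst: "dvar i * dconst a = dconst a * dvar i + dconst (derivation i a)"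
  by (simp add: dop_eq_iff dvar_def dconst_def times_dop_def plus_dop_def twisted_mult_single
      left_d_single mult_single add.commute)

lemma dvar_commute: "dvar i * dvar j = dvar j * dvar i"
  by (simp add: dop_eq_iff dvar_def times_dop_def twisted_mult_single left_d_single add.commute)

lemma dconst_add: "dconst (a + b) = dconst a + dconst b"
  by (simp add: dop_eq_iff dconst_def plus_dop_def single_add)

lemma dconst_mult: "dconst (a * b) = dconst a * dconst b"
  by (simp add: dop_eq_iff dconst_def times_dop_def twisted_mult_single mult_single)

lemma dconst_1 [simp]: "dconst 1 = 1"
  by (simp add: dop_eq_iff dconst_def one_dop_def)

definition monomial_in :: "(4 \<Rightarrow> 'r::monoid_mult) \<Rightarrow> multi_index \<Rightarrow> 'r" where
  "monomial_in f \<mu> =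
     f 0 ^ Poly_Mapping.lookup \<mu> 0 * f 1 ^ Poly_Mapping.lookup \<mu> 1 *
     f 2 ^ Poly_Mapping.lookup \<mu> 2 * f 3 ^ Poly_Mapping.lookup \<mu> 3"

definition index_order :: "multi_index \<Rightarrow> nat" where
  "index_order \<mu> = (\<Sum>i\<in>UNIV. Poly_Mapping.lookup \<mu> i)"

lemma dvar_power: "dvar i ^ n = Dop (Poly_Mapping.single (Poly_Mapping.single i n) 1)"
proof (induction n)
  case (Suc n)
  have "unit_index i + Poly_Mapping.single i n = Poly_Mapping.single i (Suc n)"
    by (simp add: unit_index_def single_add[symmetric])
  then show ?case using Suc
    by (simp add: dop_eq_iff times_dop_def dvar_def twisted_mult_single left_d_single)
qed (simp add: dop_eq_iff one_dop_def)

lemma Dop_single_mult: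
  "Dop (Poly_Mapping.single \<mu> 1) * Dop (Poly_Mapping.single \<nu> 1) =
     Dop (Poly_Mapping.single (\<mu> + \<nu>) (1::'k::differential_field))"
proof -
  have "left_mono \<mu> (Poly_Mapping.single \<nu> (1::'k)) = Poly_Mapping.single (\<mu> + \<nu>) 1"
    by (simp add: left_mono_one[symmetric] left_mono_plus)
  then show ?thesis by (simp add: dop_eq_iff times_dop_def twisted_mult_single)
qed

lemma monomial_in_dvar: "monomial_in dvar \<mu> = Dop (Poly_Mapping.single \<mu> 1)"
proof -
  have "Poly_Mapping.single 0 (Poly_Mapping.lookup \<mu> 0) + Poly_Mapping.single 1 (Poly_Mapping.lookup \<mu> 1) +
      Poly_Mapping.single 2 (Poly_Mapping.lookup \<mu> 2) + Poly_Mapping.single 3 (Poly_Mapping.lookup \<mu> 3) = \<mu>"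
    by (rule poly_mapping_eqI) (use index_cases in \<open>auto simp: lookup_add lookup_single when_def\<close>)
  then show ?thesis by (simp add: monomial_in_def dvar_power Dop_single_mult)
qed

definition adjoint_op :: "'k::differential_field dop \<Rightarrow> 'k dop" where
  "adjoint_op P =
     (\<Sum>\<mu>\<in>Poly_Mapping.keys (coeffs P).
        (-1) ^ index_order \<mu> * (monomial_in dvar \<mu> * dconst (coef P \<mu>)))"

definition adjoint_matrix :: "'k::differential_field dop ^ 'm ^ 'p \<Rightarrow> 'k dop ^ 'p ^ 'm" where
  "adjoint_matrix P = (\<chi> i j. adjoint_op (P $ j $ i))"


section \<open>Linear differential systems and differential modules\<close>

text \<open>
  A scalar linear differential equation in unknowns \<open>y\<^sup>k\<close>, \<open>k :: 'u\<close>, is a row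
  \<open>v :: 'k dop ^ 'u\<close>, standing for \<open>\<Sum>\<^sub>k (v $ k) y\<^sup>k\<close>.  A differential module is
  the quotient of the free left module \<open>'k dop ^ 'u\<close> by the submodule generated by a set of rows.
\<close>

definition left_submodule :: "('k::differential_field dop ^ 'u) set \<Rightarrow> bool" where
  "left_submodule N \<longleftrightarrow>
     0 \<in> N \<and> (\<forall>v\<in>N. \<forall>w\<in>N. v + w \<in> N) \<and> (\<forall>P. \<forall>v\<in>N. P *s v \<in> N)"

definition dspan :: "('k::differential_field dop ^ 'u) set \<Rightarrow> ('k dop ^ 'u) set" where
  "dspan E = left_submodule hull E"

definition torsion_quotient :: "('k::differential_field dop ^ 'u) set \<Rightarrow> bool" where
  "torsion_quotient N \<longleftrightarrow> (\<forall>v. \<exists>P. P \<noteq> 0 \<and> P *s v \<in> N)"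

interpretation krow: vector_space "\<lambda>a (v :: 'k::differential_field dop ^ 'u). dconst a *s v"
proof
  fix a b :: 'k and v w :: "'k dop ^ 'u"
  show "dconst a *s (v + w) = dconst a *s v + dconst a *s w"
    by (rule vec_eq_iff[THEN iffD2]) (simp add: distrib_left)
  show "dconst (a + b) *s v = dconst a *s v + dconst b *s v"
    by (rule vec_eq_iff[THEN iffD2]) (simp add: dconst_add distrib_right)
  show "dconst a *s (dconst b *s v) = dconst (a * b) *s v"
    by (rule vec_eq_iff[THEN iffD2]) (simp add: dconst_mult mult.assoc)
  show "dconst 1 *s v = v"
    by (rule vec_eq_iff[THEN iffD2]) simp
qed

abbreviation kspan :: "('k::differential_field dop ^ 'u) set \<Rightarrow> ('k dop ^ 'u) set" where
  "kspan \<equiv> krow.span"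


subsection \<open>Relative parametrizations\<close>

text \<open>
  For the inhomogeneous system \<open>A y = \<sigma>\<close>, \<open>B y = 0\<close>: the compatibility conditions on \<open>\<sigma>\<close> are the rows
  \<open>Q\<close> for which some \<open>R\<close> satisfies \<open>Q A + R B = 0\<close>.
\<close>

definition compatibility_conditions ::
    "('p::finite \<Rightarrow> 'k dop ^ 'u) \<Rightarrow> ('c::finite \<Rightarrow> 'k dop ^ 'u) \<Rightarrow>
     ('k::differential_field dop ^ 'p) set" where
  "compatibility_conditions A B =
     {Q. \<exists>R. (\<Sum>p\<in>UNIV. (Q $ p) *s A p) + (\<Sum>c\<in>UNIV. (R $ c) *s B c) = 0}"

definition relative_parametrization ::
    "('p::finite \<Rightarrow> 'k dop ^ 'u) \<Rightarrow> ('c::finite \<Rightarrow> 'k dop ^ 'u) \<Rightarrow>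
     ('k::differential_field dop ^ 'p) set \<Rightarrow> bool" where
  "relative_parametrization A B C \<longleftrightarrow> compatibility_conditions A B = dspan C"

definition minimum_parametrization ::
    "('p \<Rightarrow> 'k dop ^ 'u) \<Rightarrow> ('c \<Rightarrow> 'k::differential_field dop ^ 'u) \<Rightarrow> bool" where
  "minimum_parametrization A B \<longleftrightarrow> torsion_quotient (dspan (range A \<union> range B))"


subsection \<open>Involutive systems\<close>

definition has_class :: "multi_index \<Rightarrow> 4 \<Rightarrow> bool" where
  "has_class \<mu> i \<longleftrightarrow> (\<forall>j<i. Poly_Mapping.lookup \<mu> j = 0) \<and> Poly_Mapping.lookup \<mu> i \<noteq> 0"

text \<open>
  A linear change of the independent variables by a matrix \<open>A\<close> of constants replaces the derivations
  by \<open>d'\<^sub>i = \<Sum>\<^sub>j A\<^sub>i\<^sub>j d\<^sub>j\<close>.  An equation written in the jets \<open>d'\<^sub>\<mu> y\<^sup>k\<close> is a finitely supported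
  family of coefficients indexed by \<open>(k, \<mu>)\<close>, and \<open>row_of A\<close> is the corresponding row over \<open>D\<close>.
\<close>

definition constant_invertible :: "'k::differential_field ^ 4 ^ 4 \<Rightarrow> bool" where
  "constant_invertible A \<longleftrightarrow> invertible A \<and> (\<forall>l i j. derivation l (A $ i $ j) = 0)"

definition new_dvar :: "'k::differential_field ^ 4 ^ 4 \<Rightarrow> 4 \<Rightarrow> 'k dop" where
  "new_dvar A i = (\<Sum>j\<in>UNIV. dconst (A $ i $ j) * dvar j)"

definition row_of ::
    "'k::differential_field ^ 4 ^ 4 \<Rightarrow> ('u \<times> multi_index \<Rightarrow>\<^sub>0 'k) \<Rightarrow> 'k dop ^ 'u" where
  "row_of A c =
     (\<Sum>(k, \<mu>)\<in>Poly_Mapping.keys c.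
        axis k (dconst (Poly_Mapping.lookup c (k, \<mu>)) * monomial_in (new_dvar A) \<mu>))"

text \<open>
  \<open>B i\<close> are the equations solved with respect to jets of order \<open>q\<close> and class \<open>i\<close>, and \<open>B0\<close> the
  remaining ones, of order at most \<open>q - 1\<close>.  The number of equations in \<open>B i\<close> is maximum because
  the equations of lower class, and those of \<open>B0\<close>, contain no jet of order \<open>q\<close> and class \<open>i\<close>.
\<close>

definition solved_form ::
    "nat \<Rightarrow> (4 \<Rightarrow> ('u \<times> multi_index \<Rightarrow>\<^sub>0 'k::differential_field) set) \<Rightarrow>
     ('u \<times> multi_index \<Rightarrow>\<^sub>0 'k) set \<Rightarrow> bool" where
  "solved_form q B B0 \<longleftrightarrow>
     (\<forall>i. \<forall>c\<in>B i. \<forall>(k, \<mu>)\<in>Poly_Mapping.keys c.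
        index_order \<mu> \<le> q \<and> (index_order \<mu> = q \<longrightarrow> (\<exists>j\<le>i. has_class \<mu> j))) \<and>
     (\<forall>i. \<forall>c\<in>B i. \<exists>k \<mu>. index_order \<mu> = q \<and> has_class \<mu> i \<and>
        Poly_Mapping.lookup c (k, \<mu>) = 1 \<and>
        (\<forall>c'\<in>B i - {c}. Poly_Mapping.lookup c' (k, \<mu>) = 0)) \<and>
     (\<forall>c\<in>B0. \<forall>(k, \<mu>)\<in>Poly_Mapping.keys c. index_order \<mu> < q)"

definition involutive_system ::
    "nat \<Rightarrow> ('k::differential_field dop ^ 'u) set \<Rightarrow> bool" where
  "involutive_system q E \<longleftrightarrow>
     (\<exists>A B B0. constant_invertible A \<and> solved_form q B B0 \<and>
        kspan (row_of A ` ((\<Union>i. B i) \<union> B0)) = kspan E \<and>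
        kspan (row_of A ` ((\<Union>i. B i) \<union> B0) \<union>
               {new_dvar A j *s row_of A c | i j c. c \<in> B i \<and> j \<le> i}) =
        kspan (E \<union> {dvar j *s e | j e. e \<in> E}))"


section \<open>The Killing and Cauchy operators\<close>

text \<open>
  The components \<open>\<lambda>\<^sup>r\<^sup>s = \<lambda>\<^sup>s\<^sup>r\<close> of a symmetric tensor are indexed by the ten unordered pairs
  \<open>Upair r s\<close>.
\<close>

instance uprod :: (finite) finite
  by standard simp

text \<open>Signature \<open>(+,+,+,-)\<close>, with \<open>x\<^sup>4\<close> (index \<open>3\<close>) as time variable.\<close>

definition minkowski :: "'k::differential_field ^ 4 ^ 4" where
  "minkowski = (\<chi> i j. if i \<noteq> j then 0 else if i = 3 then -1 else 1)"

lemma matrix_inv_minkowski: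
  "matrix_inv minkowski = (minkowski :: 'a::differential_field ^ 4 ^ 4)"
proof -
  let ?m = "minkowski :: 'a ^ 4 ^ 4"
  have 1: "minkowski ** minkowski = (mat 1 :: 'a ^ 4 ^ 4)"
  proof -
    have "(\<Sum>k\<in>UNIV. minkowski $ i $ k * minkowski $ k $ j) =
        (\<Sum>k\<in>UNIV. if k = i then minkowski $ i $ i * minkowski $ i $ j else (0::'a))" for i j
      by (rule sum.cong) (auto simp: minkowski_def)
    then show ?thesis
      by (simp add: vec_eq_iff matrix_matrix_mult_def mat_def) (simp add: minkowski_def)
  qed
  have "?m ** matrix_inv ?m = mat 1 \<and> matrix_inv ?m ** ?m = mat 1"
    unfolding matrix_inv_def by (rule someI[of _ ?m]) (simp add: 1)
  then have "matrix_inv ?m = matrix_inv ?m ** (?m ** ?m)" "(matrix_inv ?m ** ?m) ** ?m = ?m"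
    by (simp_all add: 1)
  then show ?thesis by (simp add: matrix_mul_assoc)
qed

definition killing :: "'k::differential_field dop ^ 4 ^ (4 \<times> 4)" where
  "killing = (\<chi> p r. case p of (i, j) \<Rightarrow>
     dconst (minkowski $ r $ j) * dvar i + dconst (minkowski $ i $ r) * dvar j)"

text \<open>
  A row acting on arbitrary families \<open>\<sigma>\<^sup>i\<^sup>j\<close>, restricted to symmetric ones.
\<close>

definition on_symmetric :: "'k::differential_field dop ^ (4 \<times> 4) \<Rightarrow> 'k dop ^ 4 uprod" where
  "on_symmetric v = (\<Sum>i\<in>UNIV. \<Sum>j\<in>UNIV. axis (Upair i j) (v $ (i, j)))"

text \<open>The row of \<open>\<sigma> \<mapsto> d\<^sub>r \<sigma>\<^sup>r\<^sup>s\<close>.\<close>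

definition cauchy :: "4 \<Rightarrow> 'k::differential_field dop ^ 4 uprod" where
  "cauchy s = (\<Sum>r\<in>UNIV. axis (Upair r s) (dvar r))"

definition dalembertian :: "'k::differential_field dop" where
  "dalembertian = (\<Sum>i\<in>UNIV. \<Sum>j\<in>UNIV. dconst (matrix_inv minkowski $ i $ j) * (dvar i * dvar j))"

text \<open>The row of \<open>\<lambda> \<mapsto> \<box>\<lambda>\<^sup>r\<^sup>s\<close>.\<close>

definition wave :: "4 uprod \<Rightarrow> 'k::differential_field dop ^ 4 uprod" where
  "wave p = axis p dalembertian"

definition potential_system :: "('k::differential_field dop ^ 4 uprod) set" where
  "potential_system = range wave \<union> range cauchy \<union> {dvar i *s cauchy s | i s. True}"

end

theory Submission
  imports Defs
begin

text \<open>
  Multiplying an operator on the right by one with constant coefficients differentiates nothing: on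
  the left coefficients it is the commutative multiplication of polynomials in the \<open>d\<^sub>i\<close>.  The
  d'Alembertian \<open>\<box>\<close> and the Cauchy operators \<open>C\<^sub>s = d\<^sub>r \<lambda>\<^sup>r\<^sup>s\<close> have constant coefficients, so
  identities \<open>P \<box> = \<dots>\<close> can be examined in an integral domain although \<open>K\<close> may contain
  functions that are not constant.

  \<^item> \<^emph>\<open>Parametrization.\<close>  In a relation \<open>\<Sum> Q\<^sub>p \<box>\<lambda>\<^sup>p + \<Sum> R\<^sub>s C\<^sub>s = 0\<close> the diagonal unknown
    \<open>\<lambda>\<^sup>r\<^sup>r\<close> occurs in \<open>C\<^sub>r\<close> only, whence \<open>R\<^sub>r d\<^sub>r \<in> D \<box>\<close>.  As \<open>d\<^sub>r\<close> is no zero divisor modulo \<open>\<box>\<close>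
    (lemma \<open>dvar_nonzerodivisor_mod_dalembertian\<close>), \<open>R\<^sub>r = S\<^sub>r \<box>\<close>; commuting \<open>\<box>\<close> with \<open>C\<^sub>s\<close> and
    cancelling it leaves \<open>Q = - \<Sum> S\<^sub>s C\<^sub>s\<close>.  Conversely \<open>d\<^sub>r \<sigma>\<^sup>r\<^sup>s = \<box> d\<^sub>r \<lambda>\<^sup>r\<^sup>s = 0\<close>.

  \<^item> \<^emph>\<open>Minimality.\<close>  Already the equations \<open>\<box>\<lambda> = 0\<close> have a torsion module.  The \<open>M\<^sup>4\<close> rows
    \<open>d\<^sub>\<mu> v\<close> with all \<open>\<mu>\<^sub>i < M\<close> reduce modulo \<open>\<box>\<close> to the \<open>K\<close>-span of the jets with \<open>\<nu>\<^sub>0 \<le> 1\<close> and bounded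
    order, of which there are only \<open>O(M\<^sup>3)\<close>.  A linear relation between the reduced rows is an
    operator \<open>P \<noteq> 0\<close> that kills \<open>v\<close> (lemma \<open>torsion_quotient_wave\<close>).

  \<^item> \<^emph>\<open>Involution.\<close>  The given coordinates are already regular enough.  The combination
    \<open>F\<^sub>s = d\<^sub>3 C\<^sub>s + \<box>\<lambda>\<^sup>3\<^sup>s\<close> has no \<open>d\<^sub>3\<^sub>3\<close>, so the second order equations split into
    \<open>d\<^sub>0 C\<^sub>s\<close> (class 0), \<open>d\<^sub>1 C\<^sub>s\<close> (class 1), \<open>d\<^sub>2 C\<^sub>s\<close> and \<open>F\<^sub>s\<close> (class 2) and \<open>\<box>\<lambda>\<^sup>p\<close> (class 3),
    with \<open>4, 4, 8, 10\<close> equations.  The nonmultiplicative \<open>d\<^sub>j d\<^sub>i C\<^sub>s\<close> with \<open>i < j < 3\<close> become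
    multiplicative by exchanging \<open>d\<^sub>i\<close> and \<open>d\<^sub>j\<close>, and \<open>d\<^sub>3 d\<^sub>i C\<^sub>s\<close> with \<open>i < 3\<close> is the difference of the
    multiplicative \<open>d\<^sub>i F\<^sub>s\<close> and \<open>d\<^sub>i \<box>\<lambda>\<^sup>3\<^sup>s\<close>.  There remains \<open>d\<^sub>3 F\<^sub>s\<close>, which amounts to \<open>d\<^sub>3\<^sub>3 C\<^sub>s\<close> and is
    recovered from \<open>\<box> C\<^sub>s = \<Sum>\<^sub>r d\<^sub>r \<box>\<lambda>\<^sup>r\<^sup>s\<close>.

  \<^item> \<^emph>\<open>Adjoint.\<close>  The metric is constant, so the adjoint of \<open>\<omega>\<^sub>r\<^sub>j d\<^sub>i + \<omega>\<^sub>i\<^sub>r d\<^sub>j\<close> is its negative, and on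
    symmetric \<open>\<sigma>\<^sup>i\<^sup>j\<close> both terms contribute \<open>- \<omega>\<^sub>r\<^sub>s C\<^sub>s\<close>.
\<close>

section \<open>Indices, rows and coefficients\<close>

lemma index_neq [simp]:
  "(0::4) \<noteq> 1" "(0::4) \<noteq> 2" "(0::4) \<noteq> 3" "(1::4) \<noteq> 2" "(1::4) \<noteq> 3" "(2::4) \<noteq> 3"
  "(1::4) \<noteq> 0" "(2::4) \<noteq> 0" "(3::4) \<noteq> 0" "(2::4) \<noteq> 1" "(3::4) \<noteq> 1" "(3::4) \<noteq> 2"
  using index_less less_trans[OF index_less(1,2)] less_trans[OF index_less(2,3)]
    less_trans[OF index_less(1) less_trans[OF index_less(2,3)]] by auto

lemma index_le_3 [simp]: "i \<le> (3::4)"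
  using index_cases[of i] index_less(3) less_trans[OF index_less(2,3)]
    less_trans[OF index_less(1) less_trans[OF index_less(2,3)]] by auto

lemma sum_index: "sum f UNIV = f 0 + f 1 + f 2 + f (3::4)"
  for f :: "4 \<Rightarrow> 'a::comm_monoid_add"
  by (simp add: sum_4 index_4_eq_0 add_ac)

lemma lookup_unit_index: "Poly_Mapping.lookup (unit_index i) j = (if i = j then 1 else 0)"
  by (simp add: unit_index_def lookup_single when_def)

lemma unit_index_inject [simp]: "unit_index i = unit_index j \<longleftrightarrow> i = j"
  by (metis lookup_unit_index one_neq_zero)

lemma unit_index_pair_eq:
  "unit_index a + unit_index b = unit_index c + unit_index d \<longleftrightarrow>
     a = c \<and> b = d \<or> a = d \<and> b = c"
proof
  assume *: "unit_index a + unit_index b = unit_index c + unit_index d"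
  then have "Poly_Mapping.lookup (unit_index a + unit_index b) a =
      Poly_Mapping.lookup (unit_index c + unit_index d) a" by simp
  then have "c = a \<or> d = a"
    by (auto simp: lookup_add lookup_unit_index split: if_splits)
  with * show "a = c \<and> b = d \<or> a = d \<and> b = c"
    by (auto simp: add.commute)
qed (auto simp: add.commute)

lemma index_order_add: "index_order (\<mu> + \<nu>) = index_order \<mu> + index_order \<nu>"
  by (simp add: index_order_def lookup_add sum.distrib)

lemma index_order_unit [simp]: "index_order (unit_index i) = 1"
  by (simp add: index_order_def lookup_unit_index)

lemma index_order_0 [simp]: "index_order 0 = 0"
  by (simp add: index_order_def)

lemma has_class_pair: "has_class (unit_index a + unit_index b) i \<longleftrightarrow> i = min a b"
  by (auto simp: has_class_def lookup_add lookup_unit_index min_def not_le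
      split: if_splits)

lemma axis_add: "axis k (P + Q) = axis k P + (axis k Q :: 'a::monoid_add ^ 'n)"
  by (simp add: vec_eq_iff axis_def)

lemma axis_diff: "axis k (P - Q) = axis k P - (axis k Q :: 'a::group_add ^ 'n)"
  by (simp add: vec_eq_iff axis_def)

lemma axis_uminus: "axis k (- P) = - (axis k P :: 'a::group_add ^ 'n)"
  by (simp add: vec_eq_iff axis_def)

lemma axis_sum: "axis k (sum f S) = (\<Sum>x\<in>S. axis k (f x) :: 'a::comm_monoid_add ^ 'n)"
  by (induction S rule: infinite_finite_induct) (simp_all add: axis_add)

lemma smult_axis: "P *s axis k Q = (axis k (P * Q) :: 'a::semiring_1 ^ 'n)"
  by (simp add: vec_eq_iff axis_def)

lemma smult_sum: "P *s sum f S = (\<Sum>x\<in>S. P *s f x :: 'a::ring_1 ^ 'n)"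
  by (simp add: vec_eq_iff sum_distrib_left)

lemma row_expansion: "v = (\<Sum>k\<in>UNIV. axis k (v $ k))" for v :: "'a::comm_monoid_add ^ 'n"
  by (simp add: vec_eq_iff axis_def)

lemma left_submodule_dspan [simp]: "left_submodule (dspan E)"
  unfolding dspan_def by (rule hull_in) (auto simp: left_submodule_def)

lemma dspan_superset: "e \<in> E \<Longrightarrow> e \<in> dspan E"
  unfolding dspan_def by (rule hull_inc)

lemma dspan_minimal: "E \<subseteq> N \<Longrightarrow> left_submodule N \<Longrightarrow> dspan E \<subseteq> N"
  unfolding dspan_def by (rule hull_minimal)

lemma left_submodule_smult: "left_submodule N \<Longrightarrow> v \<in> N \<Longrightarrow> P *s v \<in> N"
  by (simp add: left_submodule_def)

lemma left_submodule_sum: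
  "left_submodule N \<Longrightarrow> (\<And>x. x \<in> S \<Longrightarrow> f x \<in> N) \<Longrightarrow> sum f S \<in> N"
  by (induction S rule: infinite_finite_induct) (auto simp: left_submodule_def)

text \<open>
  The combinations with coefficients in \<open>D\<close> already form a left submodule.  The form
  \<open>\<Sum> (R $ c) *s f c\<close> of its elements is the one in which compatibility conditions are written.
\<close>

lemma dspan_range:
  "dspan (range f) = {\<Sum>c\<in>UNIV. (R $ c) *s f c | R. True}"
  for f :: "'c::finite \<Rightarrow> 'k::differential_field dop ^ 'u"
proof
  have "left_submodule {\<Sum>c\<in>UNIV. (R $ c) *s f c | R. True}"
    unfolding left_submodule_def
  proof (intro conjI ballI allI)
    show "0 \<in> {\<Sum>c\<in>UNIV. (R $ c) *s f c | R. True}"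
      by (rule CollectI, rule exI[of _ 0]) simp
  next
    fix v w assume "v \<in> {\<Sum>c\<in>UNIV. (R $ c) *s f c | R. True}" "w \<in> {\<Sum>c\<in>UNIV. (R $ c) *s f c | R. True}"
    then obtain R R' where "v = (\<Sum>c\<in>UNIV. (R $ c) *s f c)" "w = (\<Sum>c\<in>UNIV. (R' $ c) *s f c)" by blast
    then have "v + w = (\<Sum>c\<in>UNIV. ((R + R') $ c) *s f c)"
      by (simp add: vector_sadd_rdistrib sum.distrib)
    then show "v + w \<in> {\<Sum>c\<in>UNIV. (R $ c) *s f c | R. True}" by blast
  next
    fix P v assume "v \<in> {\<Sum>c\<in>UNIV. (R $ c) *s f c | R. True}"
    then obtain R where "v = (\<Sum>c\<in>UNIV. (R $ c) *s f c)" by blast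
    then have "P *s v = (\<Sum>c\<in>UNIV. ((P *s R) $ c) *s f c)"
      by (simp add: smult_sum vector_smult_assoc)
    then show "P *s v \<in> {\<Sum>c\<in>UNIV. (R $ c) *s f c | R. True}" by blast
  qed
  moreover have "f c = (\<Sum>d\<in>UNIV. (axis c 1 $ d) *s f d)" for c
    by (subst sum.remove[of _ c]) (auto simp: axis_def intro!: sum.neutral)
  then have "range f \<subseteq> {\<Sum>c\<in>UNIV. (R $ c) *s f c | R. True}" by blast
  ultimately show "dspan (range f) \<subseteq> {\<Sum>c\<in>UNIV. (R $ c) *s f c | R. True}"
    by (intro dspan_minimal)
next
  show "{\<Sum>c\<in>UNIV. (R $ c) *s f c | R. True} \<subseteq> dspan (range f)"
  proof clarify
    fix R :: "'k dop ^ 'c"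
    have "(R $ c) *s f c \<in> dspan (range f)" for c
      using left_submodule_dspan[of "range f"] dspan_superset[of "f c" "range f"]
      by (simp add: left_submodule_def)
    then show "(\<Sum>c\<in>UNIV. (R $ c) *s f c) \<in> dspan (range f)"
      by (intro left_submodule_sum) auto
  qed
qed

lemma left_submodule_imp_subspace: "left_submodule N \<Longrightarrow> krow.subspace N"
  by (auto simp: left_submodule_def krow.subspace_def)

lemma coeffs_sum: "coeffs (sum f S) = (\<Sum>x\<in>S. coeffs (f x))"
  for f :: "'i \<Rightarrow> 'k::differential_field dop"
  by (induction S rule: infinite_finite_induct) (simp_all add: zero_dop_def plus_dop_def)

lemma dconst_monomial: "dconst a * monomial_in dvar \<mu> = Dop (Poly_Mapping.single \<mu> a)"
  by (simp add: monomial_in_dvar dop_eq_iff times_dop_def dconst_def twisted_mult_single mult_single)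

lemma dop_expansion:
  assumes "finite K" "Poly_Mapping.keys (coeffs P) \<subseteq> K"
  shows "P = (\<Sum>\<mu>\<in>K. dconst (coef P \<mu>) * monomial_in dvar \<mu>)"
proof -
  have "(\<Sum>\<mu>\<in>K. coef P \<mu> when \<mu> = \<nu>) = coef P \<nu>" for \<nu>
    using assms by (cases "\<nu> \<in> K") (auto simp: when_def not_in_keys_iff_lookup_eq_zero)
  then show ?thesis
    by (simp add: dop_eq_iff coeffs_sum dconst_monomial poly_mapping_eq_iff fun_eq_iff
        lookup_sum lookup_single)
qed

lemma coef_add [simp]: "coef (P + Q) \<mu> = coef P \<mu> + coef Q \<mu>"
  by (simp add: plus_dop_def lookup_add)

lemma coef_diff [simp]: "coef (P - Q) \<mu> = coef P \<mu> - coef Q \<mu>"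
  by (simp add: minus_dop_def lookup_minus)

lemma coef_uminus [simp]: "coef (- P) \<mu> = - coef P \<mu>"
  for P :: "'k::differential_field dop"
  by (simp add: uminus_dop_def)

lemma coef_0 [simp]: "coef (0::'k::differential_field dop) \<mu> = 0"
  by (simp add: zero_dop_def)

lemma coef_dvar_dvar:
  "coef (dvar i * dvar j) \<mu> = (if \<mu> = unit_index i + unit_index j then 1 else 0)"
  by (auto simp: times_dop_def dvar_def twisted_mult_single left_d_single lookup_single when_def)

lemma dconst_0 [simp]: "dconst 0 = 0"
  by (simp add: dop_eq_iff dconst_def zero_dop_def)

lemma dconst_uminus: "dconst (- a) = - dconst a"
  using dconst_add[of a "- a"] by (simp add: eq_neg_iff_add_eq_0 add.commute)

lemma dalembertian_eq:
  "dalembertian = dvar 0 * dvar 0 + dvar 1 * dvar 1 + dvar 2 * dvar 2 -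
     (dvar 3 * dvar 3 :: 'k::differential_field dop)"
  unfolding dalembertian_def matrix_inv_minkowski
  by (simp add: sum_index minkowski_def dconst_uminus)

lemma coef_dalembertian:
  "coef (dalembertian :: 'k::differential_field dop) \<mu> =
     (\<Sum>i\<in>UNIV. if \<mu> = unit_index i + unit_index i then if i = 3 then -1 else 1 else 0)"
  unfolding dalembertian_eq coef_add coef_diff coef_dvar_dvar sum_index by simp

lemma coef_dalembertian_pair:
  "coef (dalembertian :: 'k::differential_field dop) (unit_index i + unit_index j) =
     (if i = j then if i = 3 then -1 else 1 else 0)"
proof -
  have "(\<Sum>l\<in>UNIV. if unit_index i + unit_index j = unit_index l + unit_index l
        then if l = 3 then -1 else 1 else 0) =
      (\<Sum>l\<in>UNIV. if l = i then if i = j then if i = 3 then -1 else 1 else 0 else (0::'k))"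
    by (rule sum.cong) (auto simp: unit_index_pair_eq)
  then show ?thesis by (simp add: coef_dalembertian)
qed

section \<open>Operators with constant coefficients\<close>

definition constant_coeffs :: "'k::differential_field dop \<Rightarrow> bool" where
  "constant_coeffs Q \<longleftrightarrow> (\<forall>i. Poly_Mapping.map (derivation i) (coeffs Q) = 0)"

text \<open>
  The term \<open>\<partial>\<^sub>i\<close> of \<open>d\<^sub>i\<close> kills the coefficients of such a family and of all its shifts, so that only
  the shifts remain.
\<close>

lemma left_mono_constant:
  assumes "\<And>i. Poly_Mapping.map (derivation i) q = 0"
  shows "left_mono \<mu> q = Poly_Mapping.single \<mu> 1 * (q :: multi_index \<Rightarrow>\<^sub>0 'k::differential_field)"
proof (induction \<mu> rule: multi_index_induct)
  case (step \<mu> i)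
  have "Poly_Mapping.single (unit_index i) 1 * Poly_Mapping.single \<mu> (1::'k) =
      Poly_Mapping.single (unit_index i + \<mu>) 1"
    by (simp add: mult_single)
  then show ?case
    using assms by (simp add: left_mono_step step left_d_def map_derivation_shift mult.assoc[symmetric])
qed simp

text \<open>
  This is the bridge to commutative algebra.  Only the right factor has to have constant
  coefficients: the coefficients of \<open>P\<close> stand to the left of every derivation and are never
  differentiated.
\<close>

lemma coeffs_mult_constant:
  assumes "constant_coeffs Q"
  shows "coeffs (P * Q) = coeffs P * coeffs Q"
proof -
  have *: "left_mono \<mu> (coeffs Q) = Poly_Mapping.single \<mu> 1 * coeffs Q" for \<mu>
    using assms by (intro left_mono_constant) (simp add: constant_coeffs_def)
  have "twisted_mult p (coeffs Q) = p * coeffs Q" for p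
    by (induction p rule: poly_mapping_add_induct)
      (simp_all add: twisted_mult_add_left twisted_mult_single * distrib_right
        mult.assoc[symmetric] mult_single)
  then show ?thesis by (simp add: times_dop_def)
qed

lemma constant_coeffs_dvar [simp]: "constant_coeffs (dvar i)"
  by (simp add: constant_coeffs_def dvar_def)

lemma constant_coeffs_add: "constant_coeffs P \<Longrightarrow> constant_coeffs Q \<Longrightarrow> constant_coeffs (P + Q)"
  by (simp add: constant_coeffs_def plus_dop_def map_derivation_add)

lemma constant_coeffs_uminus: "constant_coeffs P \<Longrightarrow> constant_coeffs (- P)"
  using map_derivation_add[of _ "coeffs P" "- coeffs P"]
  by (simp add: constant_coeffs_def uminus_dop_def)

lemma constant_coeffs_dvar_mult: "constant_coeffs Q \<Longrightarrow> constant_coeffs (dvar i * Q)"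
  using coeffs_mult_constant[of Q "dvar i"]
  by (simp add: constant_coeffs_def dvar_def map_derivation_shift)

lemma constant_coeffs_dalembertian [simp]: "constant_coeffs dalembertian"
  unfolding dalembertian_eq diff_conv_add_uminus
  by (intro constant_coeffs_add constant_coeffs_uminus constant_coeffs_dvar_mult constant_coeffs_dvar)

lemma constant_coeffs_commute:
  "constant_coeffs P \<Longrightarrow> constant_coeffs Q \<Longrightarrow> P * Q = Q * P"
  by (simp add: dop_eq_iff coeffs_mult_constant mult.commute)

lemma constant_coeffs_cancel:
  assumes "constant_coeffs Q" "Q \<noteq> 0" "P * Q = P' * Q"
  shows "P = P'"
  using assms by (auto simp: dop_eq_iff coeffs_mult_constant zero_dop_def)

lemma lookup_shift:
  "Poly_Mapping.lookup (Poly_Mapping.single m 1 * p) (m + n) = Poly_Mapping.lookup p n"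
  for p :: "multi_index \<Rightarrow>\<^sub>0 'k::comm_ring_1"
  by (induction p rule: poly_mapping_add_induct)
    (simp_all add: mult_single lookup_single when_def distrib_left lookup_add)

section \<open>Variables are nonzerodivisors modulo the d'Alembertian\<close>

definition free_of :: "4 \<Rightarrow> (multi_index \<Rightarrow>\<^sub>0 'k::zero) \<Rightarrow> bool" where
  "free_of r p \<longleftrightarrow> (\<forall>\<mu>\<in>Poly_Mapping.keys p. Poly_Mapping.lookup \<mu> r = 0)"

lemma free_of_add: "free_of r p \<Longrightarrow> free_of r q \<Longrightarrow> free_of r (p + q :: _ \<Rightarrow>\<^sub>0 'k::comm_ring_1)"
  using keys_add[of p q] by (auto simp: free_of_def)

lemma free_of_mult: "free_of r p \<Longrightarrow> free_of r q \<Longrightarrow> free_of r (p * q :: _ \<Rightarrow>\<^sub>0 'k::comm_ring_1)"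
  using keys_mult[of p q] by (fastforce simp: free_of_def lookup_add)

text \<open>
  The summand \<open>p0\<close> is \<open>p\<close> with the variable \<open>d\<^sub>r\<close> set to \<open>0\<close>, and \<open>p1\<close> is the quotient by \<open>d\<^sub>r\<close>.
\<close>

lemma free_of_decomposition:
  fixes p :: "multi_index \<Rightarrow>\<^sub>0 'k::comm_ring_1"
  shows "\<exists>p0 p1. free_of r p0 \<and> p = p0 + Poly_Mapping.single (unit_index r) 1 * p1"
proof (induction p rule: poly_mapping_add_induct)
  case zero
  show ?case by (rule exI[of _ 0], rule exI[of _ 0]) (simp add: free_of_def)
next
  case (single m a)
  show ?case
  proof (cases "Poly_Mapping.lookup m r = 0")
    case True
    then show ?thesis
      by (intro exI[of _ "Poly_Mapping.single m a"] exI[of _ 0]) (simp add: free_of_def)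
  next
    case False
    then have "m = unit_index r + (m - unit_index r)"
      by (intro poly_mapping_eqI) (auto simp: lookup_add lookup_minus lookup_unit_index)
    then have "Poly_Mapping.single m a =
        Poly_Mapping.single (unit_index r) 1 * Poly_Mapping.single (m - unit_index r) a"
      by (simp add: mult_single)
    then show ?thesis
      by (intro exI[of _ 0] exI[of _ "Poly_Mapping.single (m - unit_index r) a"])
        (simp add: free_of_def)
  qed
next
  case (add p q)
  then obtain p0 p1 q0 q1 where
    "free_of r p0" "p = p0 + Poly_Mapping.single (unit_index r) 1 * p1"
    "free_of r q0" "q = q0 + Poly_Mapping.single (unit_index r) 1 * q1" by blast
  then show ?case
    by (intro exI[of _ "p0 + q0"] exI[of _ "p1 + q1"])
      (simp add: free_of_add distrib_left add_ac)
qed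

lemma free_of_multiple_zero:
  fixes p :: "multi_index \<Rightarrow>\<^sub>0 'k::comm_ring_1"
  assumes "free_of r (Poly_Mapping.single (unit_index r) 1 * p)"
  shows "p = 0"
proof (rule ccontr)
  assume "p \<noteq> 0"
  then obtain \<nu> where "Poly_Mapping.lookup p \<nu> \<noteq> 0"
    by (metis lookup_zero poly_mapping_eqI)
  then have "unit_index r + \<nu> \<in> Poly_Mapping.keys (Poly_Mapping.single (unit_index r) 1 * p)"
    by (simp add: in_keys_iff lookup_shift)
  with assms show False by (auto simp: free_of_def lookup_add lookup_unit_index)
qed

lemma lookup_multiple_zero:
  fixes p :: "multi_index \<Rightarrow>\<^sub>0 'k::comm_ring_1"
  assumes "Poly_Mapping.lookup \<mu> r = 0"
  shows "Poly_Mapping.lookup (Poly_Mapping.single (unit_index r) 1 * p) \<mu> = 0"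
proof -
  have "\<mu> \<notin> Poly_Mapping.keys (Poly_Mapping.single (unit_index r) 1 * p)"
    using keys_mult[of "Poly_Mapping.single (unit_index r) (1::'k)" p] assms
    by (auto simp: lookup_add lookup_unit_index)
  then show ?thesis by (simp add: not_in_keys_iff_lookup_eq_zero)
qed

text \<open>
  If \<open>d\<^sub>r\<close> divides \<open>s q\<close>, setting \<open>d\<^sub>r = 0\<close> gives \<open>s0 q0 = 0\<close>.  The monomial \<open>\<mu>\<close> survives in \<open>q0\<close>, which is
  therefore not \<open>0\<close>, hence \<open>s0 = 0\<close>: the factor \<open>d\<^sub>r\<close> is in \<open>s\<close> and cancels.
\<close>

lemma variable_nonzerodivisor_mod:
  fixes p q s :: "multi_index \<Rightarrow>\<^sub>0 'k::idom"
  assumes q: "Poly_Mapping.lookup q \<mu> \<noteq> 0" "Poly_Mapping.lookup \<mu> r = 0"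
    and eq: "p * Poly_Mapping.single (unit_index r) 1 = s * q"
  shows "\<exists>s'. p = s' * q"
proof -
  let ?X = "Poly_Mapping.single (unit_index r) (1::'k)"
  obtain q0 q1 where q0: "free_of r q0" "q = q0 + ?X * q1"
    using free_of_decomposition by blast
  obtain s0 s1 where s0: "free_of r s0" "s = s0 + ?X * s1"
    using free_of_decomposition by blast
  have "q0 \<noteq> 0"
    using q q0 by (auto simp: lookup_add lookup_multiple_zero)
  have "s0 * q0 = ?X * (p - s0 * q1 - s1 * q)"
    using eq by (simp add: q0 s0 algebra_simps)
  then have "s0 * q0 = 0"
    using free_of_multiple_zero free_of_mult[OF s0(1) q0(1)] by (metis mult_zero_right)
  with \<open>q0 \<noteq> 0\<close> have "s = ?X * s1" using s0 by simp
  with eq have "?X * (p - s1 * q) = 0" by (simp add: algebra_simps)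
  then have "free_of r (?X * (p - s1 * q))" by (simp only: free_of_def keys_zero) simp
  then have "p = s1 * q" using free_of_multiple_zero by (metis eq_iff_diff_eq_0)
  then show ?thesis ..
qed

lemma dalembertian_neq_0: "dalembertian \<noteq> (0 :: 'k::differential_field dop)"
proof
  assume "dalembertian = (0 :: 'k dop)"
  then have "coef (dalembertian :: 'k dop) (unit_index 0 + unit_index 0) = 0" by simp
  then show False by (simp add: coef_dalembertian_pair)
qed

text \<open>
  There is always another variable \<open>d\<^sub>j\<close>, and its square survives in \<open>\<box>\<close> when \<open>d\<^sub>r\<close> is set to \<open>0\<close>.
\<close>

lemma dvar_nonzerodivisor_mod_dalembertian:
  fixes P S :: "'k::differential_field dop"
  assumes "P * dvar r = S * dalembertian"
  shows "\<exists>S'. P = S' * dalembertian"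
proof -
  obtain j where "j \<noteq> r" using index_neq by metis
  have "\<exists>s'. coeffs P = s' * coeffs (dalembertian :: 'k dop)"
  proof (rule variable_nonzerodivisor_mod)
    show "coef (dalembertian :: 'k dop) (unit_index j + unit_index j) \<noteq> 0"
      by (simp add: coef_dalembertian_pair)
    show "Poly_Mapping.lookup (unit_index j + unit_index j) r = 0"
      using \<open>j \<noteq> r\<close> by (simp add: lookup_add lookup_unit_index)
    show "coeffs P * Poly_Mapping.single (unit_index r) 1 = coeffs S * coeffs dalembertian"
      using arg_cong[OF assms, of coeffs] by (simp add: coeffs_mult_constant) (simp add: dvar_def)
  qed
  then obtain s' where "coeffs P = s' * coeffs (dalembertian :: 'k dop)" ..
  then have "P = Dop s' * dalembertian" by (simp add: dop_eq_iff coeffs_mult_constant)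
  then show ?thesis ..
qed

section \<open>The compatibility conditions\<close>

lemma cauchy_nth: "cauchy s $ k = (\<Sum>r\<in>UNIV. if k = Upair r s then dvar r else 0)"
  by (simp add: cauchy_def axis_def)

lemma cauchy_nth_Upair: "cauchy s $ Upair r t = (if s = r then dvar t else if s = t then dvar r else 0)"
  by (auto simp: cauchy_nth intro: sum.neutral)

lemma sum_wave: "(\<Sum>p\<in>UNIV. (Q $ p) *s wave p) $ k = Q $ k * dalembertian"
  for Q :: "'k::differential_field dop ^ 4 uprod"
  by (simp add: wave_def smult_axis) (simp add: axis_def)

lemma dalembertian_cauchy_commute:
  "dalembertian * cauchy c $ k = cauchy c $ k * (dalembertian :: 'k::differential_field dop)"
  unfolding cauchy_nth sum_distrib_left sum_distrib_right
  by (rule sum.cong) (simp_all add: constant_coeffs_commute[of dalembertian])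

text \<open>
  Only the four diagonal components of a relation are needed to see that its coefficients \<open>R\<^sub>r\<close> are
  multiples of \<open>\<box>\<close>; after that, cancelling \<open>\<box>\<close> treats all ten components at once.
\<close>

lemma relative_parametrization_wave_cauchy:
  "relative_parametrization
     (wave :: 4 uprod \<Rightarrow> 'k::differential_field dop ^ 4 uprod) cauchy (range cauchy)"
proof -
  let ?D = "dalembertian :: 'k dop"
  have "(\<exists>R. (\<Sum>p\<in>UNIV. (Q $ p) *s wave p) + (\<Sum>c\<in>UNIV. (R $ c) *s cauchy c) = 0) \<longleftrightarrow>
      (\<exists>S. Q = (\<Sum>c\<in>UNIV. (S $ c) *s cauchy c))" (is "?lhs \<longleftrightarrow> ?rhs")
    for Q :: "'k dop ^ 4 uprod"
  proof
    assume ?lhs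
    then obtain R where "(\<Sum>p\<in>UNIV. (Q $ p) *s wave p) + (\<Sum>c\<in>UNIV. (R $ c) *s cauchy c) = 0" ..
    then have R: "(Q $ k) * ?D = - (\<Sum>c\<in>UNIV. (R $ c) * cauchy c $ k)" for k
      by (auto simp: vec_eq_iff sum_wave eq_neg_iff_add_eq_0 simp del: sum_component
          dest!: spec[of _ k]) (simp add: )
    have "\<exists>S. R $ c = S * ?D" for c
    proof (rule dvar_nonzerodivisor_mod_dalembertian)
      have "(\<Sum>c'\<in>UNIV. (R $ c') * cauchy c' $ Upair c c) = (R $ c) * dvar c"
        by (simp add: cauchy_nth_Upair if_distrib[of "\<lambda>x. _ * x"] cong: if_cong)
      then show "(R $ c) * dvar c = (- Q $ Upair c c) * ?D"
        using R[of "Upair c c"] by simp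
    qed
    then obtain S where S: "\<And>c. R $ c = S c * ?D" by metis
    have "Q $ k = (- (\<Sum>c\<in>UNIV. S c * cauchy c $ k))" for k
    proof (rule constant_coeffs_cancel[of ?D])
      show "Q $ k * ?D = - (\<Sum>c\<in>UNIV. S c * cauchy c $ k) * ?D"
        by (simp add: R S sum_distrib_right mult.assoc dalembertian_cauchy_commute)
    qed (simp_all add: dalembertian_neq_0)
    then have "Q = (\<Sum>c\<in>UNIV. ((\<chi> c. - S c) $ c) *s cauchy c)"
      by (simp add: vec_eq_iff sum_negf)
    then show ?rhs ..
  next
    assume ?rhs
    then obtain S where S: "Q = (\<Sum>c\<in>UNIV. (S $ c) *s cauchy c)" ..
    have "(\<Sum>p\<in>UNIV. (Q $ p) *s wave p) + (\<Sum>c\<in>UNIV. ((\<chi> c. - (S $ c * ?D)) $ c) *s cauchy c) = 0"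
      by (simp add: vec_eq_iff sum_wave del: sum_component) 
        (simp add: S sum_distrib_right sum_negf mult.assoc dalembertian_cauchy_commute)
    then show ?lhs ..
  qed
  then show ?thesis
    unfolding relative_parametrization_def compatibility_conditions_def dspan_range by blast
qed

section \<open>The homogeneous system is torsion\<close>

lemma dvar_dvar_monomial: "dvar i * dvar j = monomial_in dvar (unit_index i + unit_index j)"
  by (simp add: dvar_def monomial_in_dvar Dop_single_mult)

lemma monomial_mult: "monomial_in dvar \<mu> * monomial_in dvar \<nu> =
    (monomial_in dvar (\<mu> + \<nu>) :: 'k::differential_field dop)"
  by (simp add: monomial_in_dvar Dop_single_mult)

lemma coeffs_monomial_mult: "coeffs (monomial_in dvar \<mu> * P) = left_mono \<mu> (coeffs P)"
  by (simp add: monomial_in_dvar times_dop_def twisted_mult_single)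

lemma index_order_left_d:
  fixes p :: "multi_index \<Rightarrow>\<^sub>0 'k::differential_field"
  assumes "\<forall>\<nu>\<in>Poly_Mapping.keys p. index_order \<nu> \<le> m" "\<nu> \<in> Poly_Mapping.keys (left_d i p)"
  shows "index_order \<nu> \<le> Suc m"
proof -
  have "\<nu> \<in> Poly_Mapping.keys p \<or> (\<exists>b\<in>Poly_Mapping.keys p. \<nu> = unit_index i + b)"
  proof (rule ccontr)
    assume *: "\<not> ?thesis"
    have "Poly_Mapping.lookup (Poly_Mapping.map (derivation i) p) \<nu> = 0"
      using * by (simp add: lookup_map_derivation in_keys_iff)
    moreover have "\<nu> \<notin> Poly_Mapping.keys (Poly_Mapping.single (unit_index i) 1 * p)"
      using * keys_mult[of "Poly_Mapping.single (unit_index i) (1::'k)" p] by auto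
    ultimately show False using assms(2)
      by (simp add: left_d_def in_keys_iff lookup_add)
  qed
  then show ?thesis using assms(1) by (auto simp: index_order_add)
qed

lemma index_order_left_mono:
  assumes "\<forall>\<nu>\<in>Poly_Mapping.keys p. index_order \<nu> \<le> m"
  shows "\<forall>\<nu>\<in>Poly_Mapping.keys (left_mono \<mu> p). index_order \<nu> \<le> index_order \<mu> + m"
proof (induction \<mu> rule: multi_index_induct)
  case (step \<mu> i)
  then show ?case
    using index_order_left_d[of "left_mono \<mu> p"] by (auto simp: left_mono_step index_order_add)
qed (use assms in simp)

definition multi_index_of :: "nat \<times> nat \<times> nat \<times> nat \<Rightarrow> multi_index" where
  "multi_index_of = (\<lambda>(a, b, c, d). Poly_Mapping.single 0 a + Poly_Mapping.single 1 b +
     Poly_Mapping.single 2 c + Poly_Mapping.single 3 d)"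

lemma lookup_multi_index_of [simp]:
  "Poly_Mapping.lookup (multi_index_of (a, b, c, d)) 0 = a"
  "Poly_Mapping.lookup (multi_index_of (a, b, c, d)) 1 = b"
  "Poly_Mapping.lookup (multi_index_of (a, b, c, d)) 2 = c"
  "Poly_Mapping.lookup (multi_index_of (a, b, c, d)) 3 = d"
  by (simp_all add: multi_index_of_def lookup_add lookup_single when_def)

lemma multi_index_of_lookup:
  "multi_index_of (Poly_Mapping.lookup \<mu> 0, Poly_Mapping.lookup \<mu> 1,
     Poly_Mapping.lookup \<mu> 2, Poly_Mapping.lookup \<mu> 3) = \<mu>"
proof (rule poly_mapping_eqI)
  fix i show "Poly_Mapping.lookup (multi_index_of (Poly_Mapping.lookup \<mu> 0, Poly_Mapping.lookup \<mu> 1,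
     Poly_Mapping.lookup \<mu> 2, Poly_Mapping.lookup \<mu> 3)) i = Poly_Mapping.lookup \<mu> i"
    using index_cases[of i] by auto
qed

lemma inj_multi_index_of: "inj multi_index_of"
proof (rule injI)
  fix x y :: "nat \<times> nat \<times> nat \<times> nat"
  assume "multi_index_of x = multi_index_of y"
  then show "x = y"
    by (cases x; cases y) (metis lookup_multi_index_of)
qed

lemma lookup_le_index_order: "Poly_Mapping.lookup \<mu> i \<le> index_order \<mu>"
  unfolding index_order_def by (rule member_le_sum) auto

text \<open>
  The vectors \<open>r i\<close> may coincide for different \<open>i\<close>, so dependence of the set \<open>r ` I\<close> is not enough: a
  repetition is itself a relation.
\<close>

lemma (in vector_space) nontrivial_relation:
  assumes "finite I" "finite B" "card B < card I" "r ` I \<subseteq> span B"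
  shows "\<exists>c. (\<exists>i\<in>I. c i \<noteq> 0) \<and> (\<Sum>i\<in>I. scale (c i) (r i)) = 0"
proof (cases "inj_on r I")
  case True
  then have "dependent (r ` I)"
    using independent_span_bound[of B "r ` I"] assms by (auto simp: card_image)
  then obtain u where "\<exists>v\<in>r ` I. u v \<noteq> 0" "(\<Sum>v\<in>r ` I. scale (u v) v) = 0"
    using dependent_finite[of "r ` I"] assms(1) by auto
  with True show ?thesis
    by (intro exI[of _ "u \<circ> r"]) (auto simp: sum.reindex)
next
  case False
  then obtain i j where ij: "i \<in> I" "j \<in> I" "i \<noteq> j" "r i = r j"
    by (auto simp: inj_on_def)
  have "(\<Sum>k\<in>I. scale ((if k = i then 1 else 0) - (if k = j then 1 else 0)) (r k)) = r i - r j"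
    using ij assms(1)
    by (simp add: scale_left_diff_distrib sum_subtractf if_distrib[of "\<lambda>x. scale x _"] cong: if_cong)
  with ij show ?thesis
    by (intro exI[of _ "\<lambda>k. (if k = i then 1 else 0) - (if k = j then 1 else 0)"]) auto
qed

text \<open>
  The jets of order at most \<open>L\<close> that are left once \<open>\<box>\<close> is used to eliminate \<open>d\<^sub>0\<^sub>0\<close>.
\<close>

definition normal_rows :: "nat \<Rightarrow> ('k::differential_field dop ^ 'u) set" where
  "normal_rows L = {axis k (monomial_in dvar \<nu>) | k \<nu>.
     Poly_Mapping.lookup \<nu> 0 \<le> 1 \<and> index_order \<nu> \<le> L}"

text \<open>
  A jet that is not divisible by \<open>d\<^sub>0\<^sub>0\<close> has three free exponents instead of four, hence the cubic
  bound.
\<close>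

lemma card_normal_rows:
  "finite (normal_rows L :: ('k::differential_field dop ^ 'u::finite) set) \<and>
   card (normal_rows L :: ('k dop ^ 'u) set) \<le> CARD('u) * 2 * (L + 1) ^ 3"
proof -
  let ?S = "(UNIV :: 'u set) \<times> {..1::nat} \<times> {..L} \<times> {..L} \<times> {..L}"
  let ?f = "\<lambda>(k, x). axis k (monomial_in dvar (multi_index_of x)) :: 'k dop ^ 'u"
  have "normal_rows L \<subseteq> ?f ` ?S"
  proof
    fix v :: "'k dop ^ 'u" assume "v \<in> normal_rows L"
    then obtain k \<nu> where v: "v = axis k (monomial_in dvar \<nu>)"
      and \<nu>: "Poly_Mapping.lookup \<nu> 0 \<le> 1" "index_order \<nu> \<le> L"
      by (auto simp: normal_rows_def)
    have "v = ?f (k, Poly_Mapping.lookup \<nu> 0, Poly_Mapping.lookup \<nu> 1,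
        Poly_Mapping.lookup \<nu> 2, Poly_Mapping.lookup \<nu> 3)"
      by (simp add: v multi_index_of_lookup)
    moreover have "(k, Poly_Mapping.lookup \<nu> 0, Poly_Mapping.lookup \<nu> 1,
        Poly_Mapping.lookup \<nu> 2, Poly_Mapping.lookup \<nu> 3) \<in> ?S"
      using \<nu> by (auto intro: order_trans[OF lookup_le_index_order])
    ultimately show "v \<in> ?f ` ?S" by (rule image_eqI)
  qed
  moreover have "card (?f ` ?S) \<le> card ?S" by (rule card_image_le) simp
  moreover have "card ?S = CARD('u) * 2 * (L + 1) ^ 3"
    by (simp add: card_cartesian_product power3_eq_cube)
  ultimately show ?thesis
    by (metis (no_types, lifting) card_mono finite_SigmaI finite_atMost finite_class.finite_UNIV
        finite_imageI finite_subset order_trans)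
qed

lemma subspace_congruent_span:
  assumes "krow.subspace N"
  shows "krow.subspace {v. \<exists>r\<in>kspan B. v - r \<in> N}"
proof (rule krow.subspaceI)
  show "0 \<in> {v. \<exists>r\<in>kspan B. v - r \<in> N}"
    using krow.span_zero krow.subspace_0[OF assms] by force
next
  fix v w assume "v \<in> {v. \<exists>r\<in>kspan B. v - r \<in> N}" "w \<in> {v. \<exists>r\<in>kspan B. v - r \<in> N}"
  then obtain r s where "r \<in> kspan B" "v - r \<in> N" "s \<in> kspan B" "w - s \<in> N" by blast
  then have "r + s \<in> kspan B" "(v + w) - (r + s) \<in> N"
    using krow.span_add krow.subspace_add[OF assms, of "v - r" "w - s"]
    by (auto simp: algebra_simps)
  then show "v + w \<in> {v. \<exists>r\<in>kspan B. v - r \<in> N}" by blast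
next
  fix a v assume "v \<in> {v. \<exists>r\<in>kspan B. v - r \<in> N}"
  then obtain r where "r \<in> kspan B" "v - r \<in> N" by blast
  then have "dconst a *s r \<in> kspan B" "dconst a *s v - dconst a *s r \<in> N"
    using krow.span_scale krow.subspace_scale[OF assms, of "v - r" a]
    by (auto simp: krow.scale_right_diff_distrib)
  then show "dconst a *s v \<in> {v. \<exists>r\<in>kspan B. v - r \<in> N}" by blast
qed

text \<open>
  One step of the division replaces \<open>d\<^sub>0\<^sub>0\<close> by \<open>\<box> - d\<^sub>1\<^sub>1 - d\<^sub>2\<^sub>2 + d\<^sub>3\<^sub>3\<close>, which lowers the exponent of
  \<open>d\<^sub>0\<close> and keeps the order.
\<close>

lemma monomial_congruent_normal:
  assumes N: "left_submodule N" "\<And>k. wave k \<in> N" and "index_order \<mu> \<le> L"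
  shows "\<exists>r\<in>kspan (normal_rows L). axis k (monomial_in dvar \<mu>) - r \<in> (N :: ('k::differential_field dop ^ 4 uprod) set)"
  using assms(3)
proof (induction "Poly_Mapping.lookup \<mu> 0" arbitrary: \<mu> rule: less_induct)
  case less
  let ?T = "{v. \<exists>r\<in>kspan (normal_rows L). v - r \<in> N}"
  let ?u = "\<lambda>i. unit_index i + unit_index i"
  let ?m = "\<lambda>\<mu>. axis k (monomial_in dvar \<mu>) :: 'k dop ^ 4 uprod"
  have T: "krow.subspace ?T"
    using N(1) by (intro subspace_congruent_span left_submodule_imp_subspace)
  have NT: "N \<subseteq> ?T" by (auto intro!: bexI[of _ 0] krow.span_zero)
  show ?case
  proof (cases "Poly_Mapping.lookup \<mu> 0 \<le> 1")
    case True
    then have "?m \<mu> \<in> normal_rows L" using less.prems by (auto simp: normal_rows_def)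
    moreover have "?m \<mu> - ?m \<mu> \<in> N" using N(1) by (simp add: left_submodule_def)
    ultimately show ?thesis by (blast intro: krow.span_base)
  next
    case False
    define \<nu> where "\<nu> = \<mu> - ?u 0"
    have \<mu>: "\<mu> = \<nu> + ?u 0"
      using False by (intro poly_mapping_eqI) (auto simp: \<nu>_def lookup_add lookup_minus lookup_unit_index)
    have "?m (\<nu> + ?u i) \<in> ?T" if "i \<noteq> 0" for i
    proof -
      have "Poly_Mapping.lookup (\<nu> + ?u i) 0 < Poly_Mapping.lookup \<mu> 0"
        using that by (simp add: \<mu> lookup_add lookup_unit_index)
      moreover have "index_order (\<nu> + ?u i) \<le> L"
        using less.prems by (simp add: \<mu> index_order_add)
      ultimately show ?thesis using less.hyps by simp
    qed
    moreover have "monomial_in dvar \<nu> *s wave k \<in> ?T"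
    proof -
      have "monomial_in dvar \<nu> *s wave k \<in> N" using N by (simp add: left_submodule_def)
      then show ?thesis using NT by (rule set_mp[rotated])
    qed
    moreover have "?m \<mu> = monomial_in dvar \<nu> *s wave k - ?m (\<nu> + ?u 1) - ?m (\<nu> + ?u 2) + ?m (\<nu> + ?u 3)"
      by (simp add: wave_def smult_axis dalembertian_eq dvar_dvar_monomial \<mu> algebra_simps
          monomial_mult axis_add axis_diff)
    ultimately have "?m \<mu> \<in> ?T"
      by (simp only:) (intro krow.subspace_add[OF T] krow.subspace_diff[OF T]; simp)
    then show ?thesis by simp
  qed
qed

lemma row_congruent_normal:
  assumes N: "left_submodule N" "\<And>k. wave k \<in> N"
    and v: "\<And>k \<mu>. \<mu> \<in> Poly_Mapping.keys (coeffs (v $ k)) \<Longrightarrow> index_order \<mu> \<le> L"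
  shows "\<exists>r\<in>kspan (normal_rows L). v - r \<in> (N :: ('k::differential_field dop ^ 4 uprod) set)"
proof -
  let ?T = "{v. \<exists>r\<in>kspan (normal_rows L). v - r \<in> N}"
  have T: "krow.subspace ?T"
    using N(1) by (intro subspace_congruent_span left_submodule_imp_subspace)
  have "axis k (v $ k) \<in> ?T" for k
  proof -
    have "axis k (v $ k) = (\<Sum>\<mu>\<in>Poly_Mapping.keys (coeffs (v $ k)).
        dconst (coef (v $ k) \<mu>) *s axis k (monomial_in dvar \<mu>))"
      by (subst dop_expansion[of "Poly_Mapping.keys (coeffs (v $ k))" "v $ k"])
        (simp_all add: axis_sum smult_axis)
    also have "\<dots> \<in> ?T"
      by (intro krow.subspace_sum[OF T] krow.subspace_scale[OF T])
        (use monomial_congruent_normal[OF N] v in blast)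
    finally show ?thesis .
  qed
  then have "(\<Sum>k\<in>UNIV. axis k (v $ k)) \<in> ?T" by (intro krow.subspace_sum[OF T])
  then show ?thesis using row_expansion[of v] by simp
qed

text \<open>
  With \<open>v\<close> of order at most \<open>m\<close>, the rows \<open>d\<^sub>\<mu> v\<close> of the box \<open>\<mu>\<^sub>i < M\<close> have order at most \<open>4 M + m\<close>.
  They are more numerous than the normal rows of that order as soon as \<open>M\<close> is large, and a
  relation between their reductions gives the annihilating operator.
\<close>

lemma torsion_quotient_wave:
  fixes N :: "('k::differential_field dop ^ 4 uprod) set"
  assumes N: "left_submodule N" "\<And>k. wave k \<in> N"
  shows "torsion_quotient N"
  unfolding torsion_quotient_def
proof
  fix v :: "'k dop ^ 4 uprod"
  define m where "m = Max (insert 0 (index_order ` (\<Union>k. Poly_Mapping.keys (coeffs (v $ k)))))"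
  have m: "index_order \<mu> \<le> m" if "\<mu> \<in> Poly_Mapping.keys (coeffs (v $ k))" for k \<mu>
    unfolding m_def using that by (intro Max_ge) auto
  \<comment> \<open>\<open>m + 1 \<le> M\<close> bounds the number of normal rows by \<open>2 n (5 M)\<^sup>3 = 250 n M\<^sup>3\<close> with \<open>n = CARD(4 uprod)\<close>,
    and \<open>250 n < M\<close> makes this less than \<open>M\<^sup>4\<close>.\<close>
  define M where "M = 250 * CARD(4 uprod) + m + 1"
  define I where "I = {..<M} \<times> {..<M} \<times> {..<M} \<times> {..<M}"
  let ?x = "\<lambda>i. monomial_in dvar (multi_index_of i) :: 'k dop"
  let ?B = "normal_rows (4 * M + m) :: ('k dop ^ 4 uprod) set"
  have "\<exists>r\<in>kspan ?B. ?x i *s v - r \<in> N" if "i \<in> I" for i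
  proof (rule row_congruent_normal[OF N])
    fix k \<mu> assume \<mu>: "\<mu> \<in> Poly_Mapping.keys (coeffs ((?x i *s v) $ k))"
    have "index_order (multi_index_of i) \<le> 4 * M"
      using that by (auto simp: I_def index_order_def sum_index)
    moreover have "index_order \<mu> \<le> index_order (multi_index_of i) + m"
      using index_order_left_mono[of "coeffs (v $ k)" m "multi_index_of i"] m \<mu>
      by (auto simp: coeffs_monomial_mult)
    ultimately show "index_order \<mu> \<le> 4 * M + m" by simp
  qed
  then obtain r where r: "\<And>i. i \<in> I \<Longrightarrow> r i \<in> kspan ?B" "\<And>i. i \<in> I \<Longrightarrow> ?x i *s v - r i \<in> N"
    by metis
  have "card ?B \<le> CARD(4 uprod) * 2 * (4 * M + m + 1) ^ 3" using card_normal_rows by blast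
  also have "\<dots> \<le> CARD(4 uprod) * 2 * (5 * M) ^ 3"
    by (intro mult_left_mono power_mono) (auto simp: M_def)
  also have "\<dots> = 250 * CARD(4 uprod) * M ^ 3" by (simp add: power_mult_distrib)
  also have "\<dots> < M * M ^ 3" by (intro mult_strict_right_mono) (auto simp: M_def)
  also have "\<dots> = card I" by (simp add: I_def card_cartesian_product power3_eq_cube)
  finally have "card ?B < card I" .
  moreover have "finite I" by (simp add: I_def)
  moreover have "finite ?B" using card_normal_rows by blast
  moreover have "r ` I \<subseteq> kspan ?B" using r(1) by blast
  ultimately obtain c where c: "\<exists>i\<in>I. c i \<noteq> 0" "(\<Sum>i\<in>I. dconst (c i) *s r i) = 0"
    using krow.nontrivial_relation[of I ?B r] by blast
  define P where "P = (\<Sum>i\<in>I. dconst (c i) * ?x i)"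
  have "coef P (multi_index_of j) = c j" if "j \<in> I" for j
    using that inj_multi_index_of
    by (simp add: P_def coeffs_sum dconst_monomial lookup_sum lookup_single when_def inj_eq I_def
        cong: if_cong)
  with c(1) have "P \<noteq> 0" by force
  moreover have "P *s v = (\<Sum>i\<in>I. dconst (c i) *s (?x i *s v - r i))"
  proof -
    have "P *s v = (\<Sum>i\<in>I. dconst (c i) *s (?x i *s v))"
      by (simp add: P_def vec_eq_iff sum_distrib_right mult.assoc)
    then show ?thesis by (simp add: krow.scale_right_diff_distrib sum_subtractf c(2))
  qed
  then have "P *s v \<in> N"
    using r(2) N(1) by (simp only: left_submodule_sum left_submodule_smult)
  ultimately show "\<exists>P. P \<noteq> 0 \<and> P *s v \<in> N" by blast
qed

section \<open>Involution\<close>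

definition jets :: "'k::differential_field dop ^ 'u \<Rightarrow> ('u \<times> multi_index \<Rightarrow>\<^sub>0 'k)" where
  "jets v = Abs_poly_mapping (\<lambda>(k, \<mu>). coef (v $ k) \<mu>)"

lemma lookup_jets [simp]:
  "Poly_Mapping.lookup (jets v) (k, \<mu>) = coef (v $ k) \<mu>"
  for v :: "'k::differential_field dop ^ 'u::finite"
proof -
  have "{x. (case x of (k, \<mu>) \<Rightarrow> coef (v $ k) \<mu>) \<noteq> 0} =
      (\<Union>k. Pair k ` Poly_Mapping.keys (coeffs (v $ k)))"
    by (auto simp: in_keys_iff image_iff)
  then have "finite {x. (case x of (k, \<mu>) \<Rightarrow> coef (v $ k) \<mu>) \<noteq> 0}" by simp
  then show ?thesis by (simp add: jets_def lookup_Abs_poly_mapping)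
qed

lemma new_dvar_identity: "new_dvar (mat 1) = (dvar :: 4 \<Rightarrow> 'k::differential_field dop)"
  by (rule ext) (simp add: new_dvar_def mat_def if_distrib[of dconst] if_distrib[of "\<lambda>x. x * _"] cong: if_cong)

lemma row_of_jets: "row_of (mat 1) (jets v) = v"
  for v :: "'k::differential_field dop ^ 'u::finite"
proof -
  define K where "K = (\<Union>k. Poly_Mapping.keys (coeffs (v $ k)))"
  let ?t = "\<lambda>k \<mu>. axis k (dconst (coef (v $ k) \<mu>) * monomial_in dvar \<mu>) :: 'k dop ^ 'u"
  have "row_of (mat 1) (jets v) = (\<Sum>(k, \<mu>)\<in>Poly_Mapping.keys (jets v). ?t k \<mu>)"
    by (simp add: row_of_def new_dvar_identity)
  also have "\<dots> = (\<Sum>(k, \<mu>)\<in>UNIV \<times> K. ?t k \<mu>)"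
    by (rule sum.mono_neutral_left) (auto simp: K_def in_keys_iff axis_def vec_eq_iff)
  also have "\<dots> = (\<Sum>k\<in>UNIV. \<Sum>\<mu>\<in>K. ?t k \<mu>)"
    by (simp add: sum.cartesian_product)
  also have "\<dots> = (\<Sum>k\<in>UNIV. axis k (v $ k))"
  proof (rule sum.cong)
    fix k
    have "v $ k = (\<Sum>\<mu>\<in>K. dconst (coef (v $ k) \<mu>) * monomial_in dvar \<mu>)"
      by (rule dop_expansion) (auto simp: K_def)
    from arg_cong[OF this, of "axis k"] show "(\<Sum>\<mu>\<in>K. ?t k \<mu>) = axis k (v $ k)"
      by (simp only: axis_sum)
  qed simp
  finally show ?thesis using row_expansion[of v] by simp
qed

lemma constant_invertible_identity: "constant_invertible (mat 1 :: 'k::differential_field ^ 4 ^ 4)"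
proof -
  have "invertible (mat 1 :: 'k ^ 4 ^ 4)"
    unfolding invertible_def by (intro exI[of _ "mat 1"]) simp
  then show ?thesis by (simp add: constant_invertible_def mat_def)
qed

text \<open>
  A derivation is not \<open>K\<close>-linear, but \<open>d\<^sub>j a = a d\<^sub>j + \<partial>\<^sub>j a\<close> differs from \<open>a d\<^sub>j\<close> by an element of \<open>K\<close> only.
  Systems with the same \<open>K\<close>-span therefore have first prolongations with the same \<open>K\<close>-span.
\<close>

lemma dvar_smult_kspan:
  assumes "v \<in> kspan E"
  shows "dvar j *s v \<in> kspan (E \<union> {dvar j *s e | j e. e \<in> E})"
    (is "_ \<in> kspan ?F")
proof -
  have "v \<in> kspan ?F \<and> dvar j *s v \<in> kspan ?F"
    using assms
  proof (induction v rule: krow.span_induct_alt)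
    case base
    then show ?case by (simp add: krow.span_zero)
  next
    case (step a e v)
    have "e \<in> kspan ?F" "dvar j *s e \<in> kspan ?F"
      using step(1) by (blast intro: krow.span_base)+
    moreover have "dvar j *s (dconst a *s e + v) =
        dconst a *s (dvar j *s e) + dconst (derivation j a) *s e + dvar j *s v"
      by (simp add: vector_add_ldistrib vector_smult_assoc dvar_dconst vector_sadd_rdistrib)
    ultimately show ?case
      using step(2) by (simp only:) (intro conjI krow.span_add krow.span_scale; simp)
  qed
  then show ?thesis ..
qed

text \<open>
  In \<open>d\<^sub>3 C\<^sub>s\<close> the only jet of class 3 is \<open>d\<^sub>3\<^sub>3 \<lambda>\<^sup>3\<^sup>s\<close>; its coefficient in \<open>\<box>\<lambda>\<^sup>3\<^sup>s\<close> is \<open>-1\<close>, so the sum has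
  class at most 2.
\<close>

definition reduced_cauchy :: "4 \<Rightarrow> 'k::differential_field dop ^ 4 uprod" where
  "reduced_cauchy s = dvar 3 *s cauchy s + wave (Upair 3 s)"

text \<open>
  The sign of \<open>- wave p\<close> makes the coefficient of the leading jet \<open>d\<^sub>3\<^sub>3 \<lambda>\<^sup>p\<close> equal to \<open>1\<close>.
\<close>

definition solved_rows :: "4 \<Rightarrow> ('k::differential_field dop ^ 4 uprod) set" where
  "solved_rows i =
     (if i = 3 then range (\<lambda>p. - wave p)
      else if i = 2 then range (\<lambda>s. dvar 2 *s cauchy s) \<union> range reduced_cauchy
      else range (\<lambda>s. dvar i *s cauchy s))"

lemma coef_dvar_cauchy:
  "coef (dvar i * cauchy s $ k) \<mu> =
     (\<Sum>r\<in>UNIV. if k = Upair r s \<and> \<mu> = unit_index i + unit_index r then 1 else 0)"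
proof -
  have "coef (dvar i * cauchy s $ k) \<mu> = (\<Sum>r\<in>UNIV. coef (dvar i * (axis (Upair r s) (dvar r) $ k)) \<mu>)"
    by (simp add: cauchy_def sum_distrib_left coeffs_sum lookup_sum)
  also have "\<dots> = (\<Sum>r\<in>UNIV. if k = Upair r s \<and> \<mu> = unit_index i + unit_index r then 1 else 0)"
    by (rule sum.cong) (auto simp: axis_def coef_dvar_dvar)
  finally show ?thesis .
qed

lemma coef_dvar_cauchy_pair:
  "coef (dvar i * (cauchy s :: 'k::differential_field dop ^ 4 uprod) $ k) (unit_index a + unit_index b) =
     (if i = a \<and> k = Upair b s \<or> i = b \<and> k = Upair a s then 1 else 0)"
proof -
  consider "i = a" | "i \<noteq> a" "i = b" | "i \<noteq> a" "i \<noteq> b" by blast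
  then show ?thesis
  proof cases
    case 1
    have "coef (dvar i * (cauchy s :: 'k dop ^ 4 uprod) $ k) (unit_index a + unit_index b) =
        (\<Sum>r\<in>UNIV. if r = b then if k = Upair b s then 1 else 0 else 0)"
      unfolding coef_dvar_cauchy by (rule sum.cong) (auto simp: 1)
    then show ?thesis using 1 by auto
  next
    case 2
    have "coef (dvar i * (cauchy s :: 'k dop ^ 4 uprod) $ k) (unit_index a + unit_index b) =
        (\<Sum>r\<in>UNIV. if r = a then if k = Upair a s then 1 else 0 else 0)"
      unfolding coef_dvar_cauchy by (rule sum.cong) (auto simp: 2 unit_index_pair_eq)
    then show ?thesis using 2 by auto
  next
    case 3
    then show ?thesis
      unfolding coef_dvar_cauchy by (auto simp: unit_index_pair_eq intro!: sum.neutral)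
  qed
qed

lemma coef_wave:
  "coef ((wave p :: 'k::differential_field dop ^ 4 uprod) $ k) \<mu> =
     (if k = p then coef (dalembertian :: 'k dop) \<mu> else 0)"
  by (simp add: wave_def axis_def)

lemma coef_dvar_cauchy_nonzero:
  assumes "coef (dvar i * (cauchy s :: 'a::differential_field dop ^ 4 uprod) $ k) \<mu> \<noteq> 0"
  shows "\<exists>r. \<mu> = unit_index i + unit_index r"
proof -
  obtain r where "(if k = Upair r s \<and> \<mu> = unit_index i + unit_index r then 1 else 0) \<noteq> (0 :: 'a)"
    using assms unfolding coef_dvar_cauchy by (rule sum.not_neutral_contains_not_neutral)
  then show ?thesis by (auto split: if_splits)
qed

lemma coef_wave_nonzero:
  assumes "coef ((wave p :: 'k::differential_field dop ^ 4 uprod) $ k) \<mu> \<noteq> 0"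
  shows "\<exists>r. \<mu> = unit_index r + unit_index r"
proof -
  have "coef (dalembertian :: 'k dop) \<mu> \<noteq> 0"
    using assms by (simp add: coef_wave split: if_splits)
  then obtain r where "(if \<mu> = unit_index r + unit_index r then if r = 3 then -1 else 1 else 0) \<noteq> (0 :: 'k)"
    unfolding coef_dalembertian by (rule sum.not_neutral_contains_not_neutral)
  then show ?thesis by (auto split: if_splits)
qed

lemma coef_reduced_cauchy_nonzero:
  assumes nz: "coef ((reduced_cauchy s :: 'k::differential_field dop ^ 4 uprod) $ k) \<mu> \<noteq> 0"
  shows "\<exists>a b. \<mu> = unit_index a + unit_index b \<and> min a b \<le> 2"
proof -
  from nz consider "coef (dvar 3 * (cauchy s :: 'k dop ^ 4 uprod) $ k) \<mu> \<noteq> 0"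
    | "coef ((wave (Upair 3 s) :: 'k dop ^ 4 uprod) $ k) \<mu> \<noteq> 0"
    by (force simp: reduced_cauchy_def)
  then have "\<exists>a b. \<mu> = unit_index a + unit_index b"
    using coef_dvar_cauchy_nonzero coef_wave_nonzero by cases blast+
  then obtain a b where \<mu>: "\<mu> = unit_index a + unit_index b" by blast
  have "coef ((reduced_cauchy s :: 'k dop ^ 4 uprod) $ k) (unit_index 3 + unit_index 3) = 0"
    by (simp add: reduced_cauchy_def coef_dvar_cauchy_pair coef_wave coef_dalembertian_pair)
  with nz \<mu> have "a \<noteq> 3 \<or> b \<noteq> 3" by blast
  then have "a \<le> 2 \<or> b \<le> 2"
    using index_cases[of a] index_cases[of b] index_less less_trans[OF index_less(1,2)]
    by (metis less_imp_le order_refl)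
  with \<mu> have "\<mu> = unit_index a + unit_index b \<and> min a b \<le> 2" by (simp add: min_le_iff_disj)
  then show ?thesis by blast
qed

lemma solved_rows_order_class:
  assumes "v \<in> solved_rows i" "coef (v $ k) \<mu> \<noteq> 0"
  shows "index_order \<mu> = 2 \<and> (\<exists>j\<le>i. has_class \<mu> j)"
proof -
  have "\<exists>a b. \<mu> = unit_index a + unit_index b \<and> min a b \<le> i"
  proof -
    consider (wave) p where "i = 3" "v = - wave p" | (cauchy) s where "v = dvar i *s cauchy s"
      | (reduced) s where "i = 2" "v = reduced_cauchy s"
      using assms(1) by (auto simp: solved_rows_def split: if_splits)
    then show ?thesis
    proof cases
      case wave
      then show ?thesis using coef_wave_nonzero[of p k \<mu>] assms(2) by fastforce
    next
      case cauchy
      then show ?thesis using coef_dvar_cauchy_nonzero[of i s k \<mu>] assms(2) by fastforce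
    next
      case reduced
      then show ?thesis using coef_reduced_cauchy_nonzero[of s k \<mu>] assms(2) by fastforce
    qed
  qed
  then show ?thesis by (auto simp: index_order_add has_class_pair)
qed

text \<open>
  The jets solved for are \<open>d\<^sub>i\<^sub>3 \<lambda>\<^sup>3\<^sup>s\<close> in \<open>d\<^sub>i C\<^sub>s\<close> for \<open>i < 2\<close>, and \<open>d\<^sub>3\<^sub>3 \<lambda>\<^sup>p\<close> in class 3.  In class 2, for
  \<open>s \<noteq> 3\<close>, they are \<open>d\<^sub>2\<^sub>2 \<lambda>\<^sup>2\<^sup>s\<close> in \<open>d\<^sub>2 C\<^sub>s\<close> and \<open>d\<^sub>2\<^sub>3 \<lambda>\<^sup>2\<^sup>s\<close> in \<open>F\<^sub>s\<close>.  By symmetry \<open>\<lambda>\<^sup>2\<^sup>3\<close> occurs both in \<open>C\<^sub>2\<close>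
  and in \<open>C\<^sub>3\<close>, which would create conflicts for \<open>s = 3\<close>; there \<open>\<lambda>\<^sup>3\<^sup>3\<close> is used, with \<open>d\<^sub>2\<^sub>3\<close> in
  \<open>d\<^sub>2 C\<^sub>3\<close> and \<open>d\<^sub>2\<^sub>2\<close> in \<open>F\<^sub>3\<close>.
\<close>

lemma solved_rows_pivot:
  assumes "v \<in> (solved_rows i :: ('k::differential_field dop ^ 4 uprod) set)"
  shows "\<exists>k \<mu>. index_order \<mu> = 2 \<and> has_class \<mu> i \<and> coef (v $ k) \<mu> = 1 \<and>
    (\<forall>w\<in>solved_rows i - {v}. coef (w $ k) \<mu> = 0)"
proof -
  have "\<exists>k j. i \<le> j \<and> coef (v $ k) (unit_index i + unit_index j) = 1 \<and>
      (\<forall>w\<in>solved_rows i - {v}. coef (w $ k) (unit_index i + unit_index j) = 0)"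
  proof -
    consider "i = 0" | "i = 1" | "i = 2" | "i = 3" using index_cases by blast
    then show ?thesis
    proof cases
      case 1
      then obtain s where "v = dvar 0 *s cauchy s" using assms by (auto simp: solved_rows_def)
      with 1 show ?thesis
        by (intro exI[of _ "Upair 3 s"] exI[of _ 3])
          (auto simp: solved_rows_def coef_dvar_cauchy_pair split: if_splits)
    next
      case 2
      then obtain s where "v = dvar 1 *s cauchy s" using assms by (auto simp: solved_rows_def)
      with 2 show ?thesis
        by (intro exI[of _ "Upair 3 s"] exI[of _ 3])
          (auto simp: solved_rows_def coef_dvar_cauchy_pair split: if_splits)
    next
      case 3
      note simps = 3 solved_rows_def coef_dvar_cauchy_pair reduced_cauchy_def coef_wave
        coef_dalembertian_pair less_imp_le[OF index_less(3)]
      from 3 assms consider (C) s where "v = dvar 2 *s cauchy s" | (F) s where "v = reduced_cauchy s"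
        by (auto simp: solved_rows_def)
      then show ?thesis
      proof cases
        case C
        show ?thesis
        proof (cases "s = 3")
          case True
          with C show ?thesis
            by (intro exI[of _ "Upair 3 3"] exI[of _ 3]) (auto simp: simps split: if_splits)
        next
          case False
          with C show ?thesis
            by (intro exI[of _ "Upair 2 s"] exI[of _ 2]) (auto simp: simps split: if_splits)
        qed
      next
        case F
        show ?thesis
        proof (cases "s = 3")
          case True
          with F show ?thesis
            by (intro exI[of _ "Upair 3 3"] exI[of _ 2]) (auto simp: simps split: if_splits)
        next
          case False
          with F show ?thesis
            by (intro exI[of _ "Upair 2 s"] exI[of _ 3]) (auto simp: simps split: if_splits)
        qed
      qed
    next
      case 4
      then obtain p where "v = - wave p" using assms by (auto simp: solved_rows_def)
      with 4 show ?thesis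
        by (intro exI[of _ p] exI[of _ 3]) (auto simp: solved_rows_def coef_wave coef_dalembertian_pair split: if_splits)
    qed
  qed
  then obtain k j where "i \<le> j" "coef (v $ k) (unit_index i + unit_index j) = 1"
      "\<forall>w\<in>solved_rows i - {v}. coef (w $ k) (unit_index i + unit_index j) = 0"
    by blast
  then show ?thesis
    by (intro exI[of _ k] exI[of _ "unit_index i + unit_index j"])
      (simp add: index_order_add has_class_pair min_def)
qed

lemma solved_form_potential:
  "solved_form 2 (\<lambda>i. jets ` solved_rows i)
     (jets ` range (cauchy :: 4 \<Rightarrow> 'k::differential_field dop ^ 4 uprod))"
  unfolding solved_form_def
proof (intro conjI allI ballI)
  fix i c assume "c \<in> jets ` (solved_rows i :: ('k dop ^ 4 uprod) set)"
  then obtain v where v: "v \<in> solved_rows i" "c = jets v" by blast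
  show "case x of (k, \<mu>) \<Rightarrow> index_order \<mu> \<le> 2 \<and> (index_order \<mu> = 2 \<longrightarrow> (\<exists>j\<le>i. has_class \<mu> j))"
    if "x \<in> Poly_Mapping.keys c" for x
  proof -
    obtain k \<mu> where x: "x = (k, \<mu>)" by (cases x)
    have "coef (v $ k) \<mu> \<noteq> 0" using that by (simp add: x v(2) in_keys_iff)
    from solved_rows_order_class[OF v(1) this] show ?thesis by (simp add: x)
  qed
  obtain k \<mu> where "index_order \<mu> = 2" "has_class \<mu> i" "coef (v $ k) \<mu> = 1"
      "\<forall>w\<in>solved_rows i - {v}. coef (w $ k) \<mu> = 0"
    using solved_rows_pivot[OF v(1)] by blast
  then show "\<exists>k \<mu>. index_order \<mu> = 2 \<and> has_class \<mu> i \<and> Poly_Mapping.lookup c (k, \<mu>) = 1 \<and>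
      (\<forall>c'\<in>jets ` solved_rows i - {c}. Poly_Mapping.lookup c' (k, \<mu>) = 0)"
    by (intro exI[of _ k] exI[of _ \<mu>]) (auto simp: v(2))
next
  fix c x assume "c \<in> jets ` range (cauchy :: 4 \<Rightarrow> 'k dop ^ 4 uprod)" "x \<in> Poly_Mapping.keys c"
  then obtain s where "x \<in> Poly_Mapping.keys (jets (cauchy s :: 'k dop ^ 4 uprod))" by blast
  moreover obtain k \<mu> where x: "x = (k, \<mu>)" by (cases x)
  ultimately have "coef ((cauchy s :: 'k dop ^ 4 uprod) $ k) \<mu> \<noteq> 0"
    by (simp add: in_keys_iff)
  moreover have "coef ((cauchy s :: 'k dop ^ 4 uprod) $ k) \<mu> =
      (\<Sum>r\<in>UNIV. if k = Upair r s \<and> \<mu> = unit_index r then 1 else 0)"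
    unfolding cauchy_def sum_component coeffs_sum lookup_sum
    by (rule sum.cong) (auto simp: axis_def dvar_def lookup_single when_def)
  ultimately have "(\<Sum>r\<in>UNIV. if k = Upair r s \<and> \<mu> = unit_index r then 1 else 0) \<noteq> (0 :: 'k)"
    by simp
  then obtain r where "(if k = Upair r s \<and> \<mu> = unit_index r then 1 else 0) \<noteq> (0 :: 'k)"
    by (rule sum.not_neutral_contains_not_neutral)
  then have "\<exists>r. \<mu> = unit_index r" by (auto split: if_splits)
  then show "case x of (k, \<mu>) \<Rightarrow> index_order \<mu> < 2" by (auto simp: x)
qed

lemma kspan_solved_rows:
  "kspan ((\<Union>i. solved_rows i) \<union> range cauchy) =
     kspan (potential_system :: ('k::differential_field dop ^ 4 uprod) set)"
  unfolding krow.span_eq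
proof
  let ?E = "potential_system :: ('k dop ^ 4 uprod) set"
  let ?S = "(\<Union>i. solved_rows i) \<union> range cauchy :: ('k dop ^ 4 uprod) set"
  have E: "wave p \<in> kspan ?E" "cauchy s \<in> kspan ?E" "dvar i *s cauchy s \<in> kspan ?E" for p s i
    by (rule krow.span_base; auto simp: potential_system_def)+
  have "v \<in> kspan ?E" if "v \<in> solved_rows i" for v i
    using that by (auto simp: solved_rows_def reduced_cauchy_def E krow.span_neg krow.span_add
        split: if_splits)
  then show "?S \<subseteq> kspan ?E" using E(2) by blast
  have S: "v \<in> kspan ?S" if "v \<in> solved_rows i \<or> v \<in> range cauchy" for v i
    using that by (blast intro: krow.span_base)
  have wave: "wave p \<in> kspan ?S" for p
    using krow.span_neg[OF S[of "- wave p" 3]] by (simp add: solved_rows_def)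
  have "dvar i *s cauchy s \<in> kspan ?S" for i s
  proof (cases "i = 3")
    case True
    have "reduced_cauchy s \<in> kspan ?S" by (rule S[of _ 2]) (simp add: solved_rows_def)
    from krow.span_diff[OF this wave[of "Upair 3 s"]] show ?thesis
      by (simp add: reduced_cauchy_def True)
  qed (rule S[of _ i], simp add: solved_rows_def)
  with wave S show "?E \<subseteq> kspan ?S" by (auto simp: potential_system_def)
qed

text \<open>
  This is \<open>\<box> C\<^sub>s = \<Sum>\<^sub>r d\<^sub>r \<box>\<lambda>\<^sup>r\<^sup>s\<close> solved for its term \<open>d\<^sub>3\<^sub>3 C\<^sub>s\<close>, the one derivative
  that exchanging derivations does not reach.
\<close>

lemma wave_cauchy_identity:
  "dvar 3 *s (dvar 3 *s cauchy s) =
     dvar 0 *s (dvar 0 *s cauchy s) + dvar 1 *s (dvar 1 *s cauchy s) + dvar 2 *s (dvar 2 *s cauchy s) -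
     (\<Sum>r\<in>UNIV. dvar r *s (wave (Upair r s) :: 'k::differential_field dop ^ 4 uprod))"
proof -
  have "(\<Sum>r\<in>UNIV. dvar r *s (wave (Upair r s) :: 'k dop ^ 4 uprod)) = dalembertian *s cauchy s"
    by (simp add: cauchy_def wave_def smult_sum smult_axis constant_coeffs_commute[of dalembertian])
  also have "\<dots> = dvar 0 *s (dvar 0 *s cauchy s) + dvar 1 *s (dvar 1 *s cauchy s) +
      dvar 2 *s (dvar 2 *s cauchy s) - dvar 3 *s (dvar 3 *s cauchy s)"
    by (simp add: dalembertian_eq vec_eq_iff algebra_simps)
  finally show ?thesis by simp
qed

text \<open>
  All derivatives of \<open>\<box>\<lambda>\<^sup>p\<close> are multiplicative.  For \<open>d\<^sub>j d\<^sub>i C\<^sub>s\<close> one may assume \<open>j \<le> i\<close>: if \<open>i < 3\<close>, it is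
  a multiplicative derivative of \<open>d\<^sub>i C\<^sub>s\<close>; if \<open>j < i = 3\<close>, it is obtained from the multiplicative
  \<open>d\<^sub>j F\<^sub>s\<close>; and \<open>i = j = 3\<close> is the preceding identity.
\<close>

lemma kspan_prolongation:
  "kspan ((\<Union>i. solved_rows i) \<union> range cauchy \<union> {dvar j *s v | i j v. v \<in> solved_rows i \<and> j \<le> i}) =
     kspan (potential_system \<union> {dvar j *s e | j e. e \<in> (potential_system :: ('k::differential_field dop ^ 4 uprod) set)})"
  (is "kspan (?S \<union> ?P) = kspan ?F")
  unfolding krow.span_eq
proof
  let ?E = "potential_system :: ('k dop ^ 4 uprod) set"
  have S: "?S \<subseteq> kspan ?E" using krow.span_superset[of ?S] by (simp only: kspan_solved_rows)
  moreover have "kspan ?E \<subseteq> kspan ?F" by (rule krow.span_mono) simp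
  ultimately have "?S \<subseteq> kspan ?F" by (rule subset_trans)
  moreover have "?P \<subseteq> kspan ?F"
  proof clarify
    fix i j v assume "v \<in> (solved_rows i :: ('k dop ^ 4 uprod) set)"
    with S have "v \<in> kspan ?E" by blast
    then show "dvar j *s v \<in> kspan ?F" by (rule dvar_smult_kspan)
  qed
  ultimately show "?S \<union> ?P \<subseteq> kspan ?F" by (rule Un_least)
next
  let ?E = "potential_system :: ('k dop ^ 4 uprod) set"
  let ?W = "kspan (?S \<union> ?P)"
  have "kspan ?S \<subseteq> ?W" by (rule krow.span_mono) simp
  then have E: "?E \<subseteq> ?W"
    unfolding kspan_solved_rows using krow.span_superset[of ?E] by (rule subset_trans[rotated])
  have P: "dvar j *s v \<in> ?W" if "v \<in> solved_rows i" "j \<le> i" for i j v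
    by (rule krow.span_base) (use that in blast)
  have wave: "dvar j *s wave p \<in> ?W" for j p
  proof -
    have "dvar j *s (- wave p) \<in> ?W" by (rule P[of _ 3]) (simp_all add: solved_rows_def)
    moreover have "dvar j *s wave p = - (dvar j *s (- wave p :: 'k dop ^ 4 uprod))"
      by (simp add: vec_eq_iff)
    ultimately show ?thesis by (simp only: krow.span_neg)
  qed
  have low: "dvar j *s (dvar i *s cauchy s) \<in> ?W" if "j \<le> i" "i \<noteq> 3" for i j s
    by (rule P[OF _ that(1)]) (use that(2) in \<open>simp add: solved_rows_def\<close>)
  have top: "dvar j *s (dvar 3 *s cauchy s) \<in> ?W" if "j \<noteq> 3" for j s
  proof -
    have "j \<le> 2"
      using that index_cases[of j] index_less less_trans[OF index_less(1,2)] by auto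
    then have "dvar j *s reduced_cauchy s \<in> ?W"
      by (intro P[of _ 2]) (simp_all add: solved_rows_def)
    from krow.span_diff[OF this wave[of j "Upair 3 s"]] show ?thesis
      by (simp add: reduced_cauchy_def vector_add_ldistrib)
  qed
  have cauchy: "dvar j *s (dvar i *s cauchy s) \<in> ?W" for i j s
  proof -
    have commute: "dvar j *s (dvar i *s cauchy s) = dvar i *s (dvar j *s cauchy s)" for i j
      by (simp add: vector_smult_assoc dvar_commute[of i j])
    consider "j \<le> i" "i \<noteq> 3" | "i \<le> j" "j \<noteq> 3" | "i = 3" "j \<noteq> 3" | "i \<noteq> 3" "j = 3" | "i = 3" "j = 3"
      using linear[of i j] by blast
    then show ?thesis
    proof cases
      case 1
      then show ?thesis by (intro low)
    next
      case 2
      then show ?thesis unfolding commute[of j i] by (intro low)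
    next
      case 3
      then show ?thesis using top by simp
    next
      case 4
      then show ?thesis unfolding 4(2) commute[of 3 i] by (intro top)
    next
      case 5
      show ?thesis
        unfolding 5 wave_cauchy_identity
        by (intro krow.span_add krow.span_diff krow.span_sum low wave) auto
    qed
  qed
  have "dvar j *s e \<in> ?W" if e: "e \<in> ?E" for j e
  proof -
    consider p where "e = wave p" | s where "e = cauchy s" | i s where "e = dvar i *s cauchy s"
      using e by (auto simp: potential_system_def)
    then show ?thesis
    proof cases
      case 1
      then show ?thesis using wave by simp
    next
      case 2
      then have "dvar j *s e \<in> ?E" by (auto simp: potential_system_def)
      then show ?thesis using E by (rule set_mp[rotated])
    next
      case 3
      then show ?thesis using cauchy by simp
    qed
  qed
  then have "{dvar j *s e | j e. e \<in> ?E} \<subseteq> ?W" by blast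
  with E show "?F \<subseteq> ?W" by (rule Un_least)
qed

lemma involutive_potential_system:
  "involutive_system 2 (potential_system :: ('k::differential_field dop ^ 4 uprod) set)"
proof -
  let ?B = "\<lambda>i. jets ` (solved_rows i :: ('k dop ^ 4 uprod) set)"
  let ?C = "jets ` range (cauchy :: 4 \<Rightarrow> 'k dop ^ 4 uprod)"
  have rows: "row_of (mat 1) ` ((\<Union>i. ?B i) \<union> ?C) = (\<Union>i. solved_rows i) \<union> range cauchy"
    by (simp add: image_Un image_UN image_image row_of_jets)
  have prolonged: "{new_dvar (mat 1) j *s row_of (mat 1) c | i j c. c \<in> ?B i \<and> j \<le> i} =
      {dvar j *s v | i j v. v \<in> solved_rows i \<and> j \<le> i}"
    (is "?L = ?R")
  proof
    show "?L \<subseteq> ?R" by (clarsimp simp: new_dvar_identity row_of_jets) blast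
    show "?R \<subseteq> ?L"
    proof clarify
      fix i j and v :: "'k dop ^ 4 uprod" assume "v \<in> solved_rows i" "j \<le> i"
      then show "\<exists>i' j' c. dvar j *s v = new_dvar (mat 1) j' *s row_of (mat 1) c \<and> c \<in> ?B i' \<and> j' \<le> i'"
        by (intro exI[of _ i] exI[of _ j] exI[of _ "jets v"]) (simp add: new_dvar_identity row_of_jets)
    qed
  qed
  show ?thesis
    unfolding involutive_system_def
    by (intro exI[of _ "mat 1"] exI[of _ ?B] exI[of _ ?C])
      (simp only: rows prolonged constant_invertible_identity solved_form_potential
        kspan_solved_rows kspan_prolongation simp_thms)
qed

section \<open>The adjoint of the Killing operator\<close>

lemma adjoint_op_superset:
  assumes "finite S" "Poly_Mapping.keys (coeffs P) \<subseteq> S"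
  shows "adjoint_op P = (\<Sum>\<mu>\<in>S. (-1) ^ index_order \<mu> * (monomial_in dvar \<mu> * dconst (coef P \<mu>)))"
  unfolding adjoint_op_def
  by (rule sum.mono_neutral_left) (use assms in \<open>auto simp: in_keys_iff\<close>)

lemma adjoint_op_add: "adjoint_op (P + Q) = adjoint_op P + adjoint_op Q"
proof -
  let ?S = "Poly_Mapping.keys (coeffs P) \<union> Poly_Mapping.keys (coeffs Q)"
  have "Poly_Mapping.keys (coeffs (P + Q)) \<subseteq> ?S"
    unfolding plus_dop_def coeffs_Dop by (rule keys_add)
  then show ?thesis
    by (simp add: adjoint_op_superset[of ?S] dconst_add distrib_left sum.distrib)
qed

lemma adjoint_op_first_order: "adjoint_op (dconst a * dvar i) = - (dvar i * dconst a)"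
proof -
  have *: "dvar i = monomial_in dvar (unit_index i)"
    by (simp add: dvar_def monomial_in_dvar)
  show ?thesis
    unfolding * dconst_monomial
    by (subst adjoint_op_superset[of "{unit_index i}"]) auto
qed

lemma dvar_dconst_minkowski:
  "dvar i * dconst (minkowski $ r $ s) = dconst (minkowski $ r $ s) * (dvar i :: 'k::differential_field dop)"
proof -
  have "derivation i (- 1 :: 'k) = 0"
    using derivation_add[of i 1 "- 1 :: 'k"] by simp
  then show ?thesis by (simp add: dvar_dconst minkowski_def)
qed

text \<open>
  Both terms of the Killing operator give the same sum: \<open>\<sigma>\<^sup>i\<^sup>j\<close> and \<open>\<sigma>\<^sup>j\<^sup>i\<close> are the same unknown, which
  exchanges the roles of \<open>i\<close> and \<open>j\<close>.
\<close>

lemma adjoint_killing: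
  "on_symmetric (adjoint_matrix killing $ r) =
     (\<Sum>s\<in>UNIV. dconst (- 2 * minkowski $ r $ s) *s (cauchy s :: 'k::differential_field dop ^ 4 uprod))"
proof -
  let ?w = "\<lambda>s. dconst (minkowski $ r $ s) :: 'k dop"
  have sym: "minkowski $ i $ r = (minkowski $ r $ i :: 'k)" for i
    by (simp add: minkowski_def)
  have Upair_commute: "Upair i j = Upair j i" for i j :: 4 by simp
  have cauchy: "?w s *s cauchy s = (\<Sum>i\<in>UNIV. axis (Upair i s) (?w s * dvar i))" for s
    by (simp add: cauchy_def smult_sum smult_axis)
  have "on_symmetric (adjoint_matrix killing $ r) =
      (\<Sum>i\<in>UNIV. \<Sum>j\<in>UNIV. axis (Upair i j) (- (?w j * dvar i) - ?w i * dvar j))"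
    by (simp add: on_symmetric_def adjoint_matrix_def killing_def adjoint_op_add
        adjoint_op_first_order dvar_dconst_minkowski sym)
  also have "\<dots> = - (\<Sum>i\<in>UNIV. \<Sum>j\<in>UNIV. axis (Upair i j) (?w j * dvar i)) -
      (\<Sum>i\<in>UNIV. \<Sum>j\<in>UNIV. axis (Upair i j) (?w i * dvar j))"
    by (simp add: axis_diff axis_uminus sum_subtractf sum_negf)
  also have "(\<Sum>i\<in>UNIV. \<Sum>j\<in>UNIV. axis (Upair i j) (?w j * dvar i)) = (\<Sum>s\<in>UNIV. ?w s *s cauchy s)"
    unfolding cauchy by (rule sum.swap)
  also have "(\<Sum>i\<in>UNIV. \<Sum>j\<in>UNIV. axis (Upair i j) (?w i * dvar j)) = (\<Sum>s\<in>UNIV. ?w s *s cauchy s)"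
    unfolding cauchy by (intro sum.cong refl) (simp add: Upair_commute)
  also have "- (\<Sum>s\<in>UNIV. ?w s *s cauchy s) - (\<Sum>s\<in>UNIV. ?w s *s cauchy s) =
      (\<Sum>s\<in>UNIV. dconst (- 2 * minkowski $ r $ s) *s cauchy s)"
  proof -
    have "dconst (- 2 * minkowski $ r $ s) = - ?w s - ?w s" for s
    proof -
      have "- 2 * minkowski $ r $ s = - minkowski $ r $ s + - (minkowski $ r $ s :: 'k)" by simp
      then show ?thesis by (simp only: dconst_add dconst_uminus) simp
    qed
    then show ?thesis
      by (simp add: vec_eq_iff sum_subtractf sum_negf left_diff_distrib)
  qed
  finally show ?thesis .
qed

section \<open>The proposition\<close>

theorem proposition4:
  shows "relative_parametrization
           (wave :: 4 uprod \<Rightarrow> 'k::differential_field dop ^ 4 uprod) cauchy (range cauchy) \<and>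
         minimum_parametrization
           (wave :: 4 uprod \<Rightarrow> 'k dop ^ 4 uprod) cauchy \<and>
         involutive_system 2 (potential_system :: ('k dop ^ 4 uprod) set) \<and>
         (\<forall>r. on_symmetric (adjoint_matrix killing $ r) =
           (\<Sum>s\<in>UNIV. dconst (- 2 * minkowski $ r $ s) *s (cauchy s :: 'k dop ^ 4 uprod)))"
proof (intro conjI allI)
  show "minimum_parametrization (wave :: 4 uprod \<Rightarrow> 'k dop ^ 4 uprod) cauchy"
    unfolding minimum_parametrization_def
    by (rule torsion_quotient_wave) (auto intro: dspan_superset)
qed (rule relative_parametrization_wave_cauchy involutive_potential_system adjoint_killing)+

end
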